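(* Let $T$ be a tree with vertices $1,2,\ldots,n$ that is NEB at vertex $n$, let $A\in S^-(T)$, and let $f:\mathbb{R}^{n-1}\to\mathbb{R}^{n-1}$ be the polynomial map associated with $T$ defined in the context. If $A$ has the Duarte property with respect to vertex $n$, then the Jacobian matrix $\operatorname{Jac}(f)|_A$ is nonsingular.
   Context: For a real skew-symmetric matrix $A=[a_{i,j}]$ of order $n$, its graph $G(A)$ has vertex set $\{1,\ldots,n\}$ and edge set $\{\{i,j\}: a_{i,j}\ne 0,\ i<j\}$. $S^-(T)$ is the set of all real skew-symmetric matrices whose graph is $T$. For a vertex $w$ of a tree $T$, $T(w)$ is the forest obtained by deleting $w$; for a neighbor $v$ of $w$, $T_v(w)$ is the connected component of $T(w)$ containing $v$. For $A\in S^-(T)$, $A(w)$ and $A_v(w)$ denote the principal submatrices of $A$ corresponding to $T(w)$ and $T_v(w)$ (rows and columns keep their vertex labels). NEB (nearly even branching; recursive): let $T$ be a tree on $n$ vertices and $w$ a vertex of $T$. If $n=1$, $T$ is NEB at $w$. If $n\ge2$, $T$ is NEB at $w$ if (i) $T(w)$ has exactly one odd component (a connected component with an odd number of vertices) when $n$ is even, and no odd component when $n$ is odd; and (ii) for each neighbor $v$ of $w$ in $T$, $T_v(w)$ is NEB at $v$. Order on $\mathrm{i}\mathbb{R}$: $a\le b$ means $-\mathrm{i}a\le-\mathrm{i}b$ as real numbers. Spectra of real skew-symmetric matrices (contained in $\mathrm{i}\mathbb{R}$) are listed with multiplicity in increasing order; $\{\mu_1,\ldots,\mu_{n-1}\}$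 strictly interlaces $\{\lambda_1,\ldots,\lambda_n\}$ if $\lambda_1<\mu_1<\lambda_2<\cdots<\mu_{n-1}<\lambda_n$. Duarte property (recursive): let $A$ be a matrix whose graph is a tree and $w$ a vertex of $G(A)$. If $G(A)$ has just one vertex, $A$ has the Duarte property with respect to $w$. If $G(A)$ has more than one vertex, $A$ has the Duarte property with respect to $w$ provided the eigenvalues of $A(w)$ strictly interlace those of $A$ and, for each neighbor $v$ of $w$, $A_v(w)$ has the Duarte property with respect to $v$. The map $f$: let the edges of $T$ be $e_k=\{i_k,j_k\}$ with $i_k<j_k$, $k=1,\ldots,n-1$. For $x=(x_1,\ldots,x_{n-1})\in\mathbb{R}^{n-1}$, $M=M(x)$ is the $n\times n$ matrix with $x_k$ in position $(i_k,j_k)$ and $-x_k$ in position $(j_k,i_k)$ for $k=1,\ldots,n-1$, and zeros elsewhere; $N=N(x)$ is the matrix obtained from $M(x)$ by deleting its last row and column. Then $$f(x)=\left(\tfrac{\operatorname{tr}M^2}{4},\tfrac{\operatorname{tr}M^4}{8},\ldots,\tfrac{\operatorname{tr}M^{2m}}{4m},\tfrac{\operatorname{tr}N^2}{4},\tfrac{\operatorname{tr}N^4}{8},\ldots,\tfrac{\operatorname{tr}N^{2(m-1)}}{4(m-1)}\right)\quad\text{if } n=2m,$$ $$f(x)=\left(\tfrac{\operatorname{tr}M^2}{4},\tfrac{\operatorname{tr}M^4}{8},\ldots,\tfrac{\operatorname{tr}M^{2m}}{4m},\tfrac{\operatorname{tr}N^2}{4},\tfrac{\operatorname{tr}N^4}{8},\ldots,\tfrac{\operatorname{tr}N^{2m}}{4m}\right)\quad\text{if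 } n=2m+1.$$ For $A=[a_{i,j}]\in S^-(T)$, $\operatorname{Jac}(f)|_A$ denotes the Jacobian matrix of $f$ evaluated at the point $x_k=a_{i_k,j_k}$, $k=1,\ldots,n-1$. *)

theory Defs
  imports
    "HOL-Analysis.Analysis"
    "Jordan_Normal_Form.Char_Poly"
    "Jordan_Normal_Form.DL_Submatrix"
begin

no_notation vec_nth (infixl "$" 90)
no_notation inner (infix "\<bullet>" 70)
hide_const (open) Finite_Cartesian_Product.mat Finite_Cartesian_Product.vec Determinants.det
  Finite_Cartesian_Product.row Cartesian_Euclidean_Space.jacobian

subsection \<open>Graphs and trees\<close>

type_synonym 'a ugraph = "'a set \<times> 'a set set"

abbreviation verts :: "'a ugraph \<Rightarrow> 'a set" where "verts \<equiv> fst"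
abbreviation edges :: "'a ugraph \<Rightarrow> 'a set set" where "edges \<equiv> snd"

definition simple_graph :: "'a ugraph \<Rightarrow> bool" where
  "simple_graph G \<longleftrightarrow> finite (verts G) \<and> (\<forall>e\<in>edges G. e \<subseteq> verts G \<and> card e = 2)"

definition adj :: "'a ugraph \<Rightarrow> 'a rel" where
  "adj G = {(u, v). {u, v} \<in> edges G}"

definition connected_graph :: "'a ugraph \<Rightarrow> bool" where
  "connected_graph G \<longleftrightarrow> verts G \<noteq> {} \<and> (\<forall>u\<in>verts G. \<forall>v\<in>verts G. (u, v) \<in> (adj G)\<^sup>*)"

definition is_cycle :: "'a ugraph \<Rightarrow> 'a list \<Rightarrow> bool" where
  "is_cycle G vs \<longleftrightarrow> length vs \<ge> 3 \<and> distinct vs \<and>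
     (\<forall>i<length vs. {vs ! i, vs ! (Suc i mod length vs)} \<in> edges G)"

definition is_tree :: "'a ugraph \<Rightarrow> bool" where
  "is_tree G \<longleftrightarrow> simple_graph G \<and> connected_graph G \<and> \<not> (\<exists>vs. is_cycle G vs)"

definition induced :: "'a ugraph \<Rightarrow> 'a set \<Rightarrow> 'a ugraph" where
  "induced G S = (S, {e \<in> edges G. e \<subseteq> S})"

definition delete_vertex :: "'a ugraph \<Rightarrow> 'a \<Rightarrow> 'a ugraph" where
  "delete_vertex G w = induced G (verts G - {w})"

text \<open>A component is represented by its vertex set.\<close>
definition components :: "'a ugraph \<Rightarrow> 'a set set" where
  "components G = verts G // (adj G)\<^sup>*"

definition odd_components :: "'a ugraph \<Rightarrow> 'a set set" where
  "odd_components G = {C \<in> components G. odd (card C)}"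

text \<open>The vertex set of \<open>T\<^sub>v(w)\<close>, for a neighbour \<open>v\<close> of \<open>w\<close>.\<close>
definition branch_verts :: "'a ugraph \<Rightarrow> 'a \<Rightarrow> 'a \<Rightarrow> 'a set" where
  "branch_verts G w v = (adj (delete_vertex G w))\<^sup>* `` {v}"

definition branch :: "'a ugraph \<Rightarrow> 'a \<Rightarrow> 'a \<Rightarrow> 'a ugraph" where
  "branch G w v = induced G (branch_verts G w v)"

text \<open>Nearly even branching of the tree \<open>T\<close> at \<open>w\<close>.  The recursion is well-founded on finite
  graphs because branches are smaller, so the inductive predicate is the recursive notion.\<close>
inductive neb :: "'a ugraph \<Rightarrow> 'a \<Rightarrow> bool" where
  neb_single: "verts T = {w} \<Longrightarrow> neb T w"
| neb_step: "\<lbrakk>w \<in> verts T; card (verts T) \<ge> 2;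
     even (card (verts T)) \<Longrightarrow> card (odd_components (delete_vertex T w)) = 1;
     odd (card (verts T)) \<Longrightarrow> odd_components (delete_vertex T w) = {};
     \<And>v. {w, v} \<in> edges T \<Longrightarrow> neb (branch T w v) v\<rbrakk> \<Longrightarrow> neb T w"


subsection \<open>Skew-symmetric matrices and the Duarte property\<close>

text \<open>Matrix indices start at 0 in the matrix library, so the vertices of the graph of an
  \<open>n \<times> n\<close> matrix are \<open>0, \<dots>, n - 1\<close> instead of \<open>1, \<dots>, n\<close>; the last vertex is \<open>n - 1\<close>.\<close>
definition graph_of :: "real mat \<Rightarrow> nat ugraph" where
  "graph_of A = ({..<dim_row A}, {{i, j} | i j. i < j \<and> j < dim_row A \<and> A $$ (i, j) \<noteq> 0})"

definition skew_matrices :: "nat ugraph \<Rightarrow> real mat set" where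
  "skew_matrices T = {A. square_mat A \<and> transpose_mat A = - A \<and> graph_of A = T}"

text \<open>The order is only used for purely imaginary numbers.\<close>
definition imag_le :: "complex \<Rightarrow> complex \<Rightarrow> bool" where
  "imag_le a b \<longleftrightarrow> Re (- \<i> * a) \<le> Re (- \<i> * b)"

definition imag_less :: "complex \<Rightarrow> complex \<Rightarrow> bool" where
  "imag_less a b \<longleftrightarrow> Re (- \<i> * a) < Re (- \<i> * b)"

text \<open>\<open>ls\<close> lists the complex eigenvalues of \<open>A\<close> with multiplicity in increasing order.  For
  skew-symmetric \<open>A\<close> these lie on the imaginary axis, so the list exists and is unique.\<close>
definition spectrum_list :: "real mat \<Rightarrow> complex list \<Rightarrow> bool" where
  "spectrum_list A ls \<longleftrightarrow>
     mset ls = proots (char_poly (map_mat complex_of_real A)) \<and> sorted_wrt imag_le ls"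

definition strictly_interlaces :: "complex list \<Rightarrow> complex list \<Rightarrow> bool" where
  "strictly_interlaces ms ls \<longleftrightarrow> length ls = Suc (length ms) \<and>
     (\<forall>i<length ms. imag_less (ls ! i) (ms ! i) \<and> imag_less (ms ! i) (ls ! Suc i))"

definition eigenvalues_strictly_interlace :: "real mat \<Rightarrow> real mat \<Rightarrow> bool" where
  "eigenvalues_strictly_interlace B A \<longleftrightarrow>
     (\<exists>ms ls. spectrum_list B ms \<and> spectrum_list A ls \<and> strictly_interlaces ms ls)"

text \<open>\<open>duarte_on A S w\<close>: the principal submatrix \<open>A[S]\<close> on the rows and columns in \<open>S\<close> has the
  Duarte property with respect to \<open>w\<close>.  Carrying \<open>S\<close> along the recursion keeps the vertex labels
  of the submatrices; the labelled graph of \<open>A[S]\<close> is the subgraph of \<open>graph_of A\<close>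
  induced by \<open>S\<close>.\<close>
inductive duarte_on :: "real mat \<Rightarrow> nat set \<Rightarrow> nat \<Rightarrow> bool" for A where
  duarte_single: "duarte_on A {w} w"
| duarte_step: "\<lbrakk>w \<in> S; card S \<ge> 2;
     eigenvalues_strictly_interlace (submatrix A (S - {w}) (S - {w})) (submatrix A S S);
     \<And>v. {w, v} \<in> edges (induced (graph_of A) S) \<Longrightarrow>
        duarte_on A (branch_verts (induced (graph_of A) S) w v) v\<rbrakk> \<Longrightarrow> duarte_on A S w"

definition duarte :: "real mat \<Rightarrow> nat \<Rightarrow> bool" where
  "duarte A w \<longleftrightarrow> duarte_on A (verts (graph_of A)) w"


subsection \<open>The polynomial map of a tree\<close>

text \<open>\<open>e k = (i\<^sub>k, j\<^sub>k)\<close> lists the edges \<open>{i\<^sub>k, j\<^sub>k}\<close>, \<open>i\<^sub>k < j\<^sub>k\<close>, without repetition.\<close>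
definition edge_enumeration :: "nat \<Rightarrow> nat ugraph \<Rightarrow> (nat \<Rightarrow> nat \<times> nat) \<Rightarrow> bool" where
  "edge_enumeration n T e \<longleftrightarrow>
     bij_betw (\<lambda>k. {fst (e k), snd (e k)}) {..<n - 1} (edges T) \<and>
     (\<forall>k<n - 1. fst (e k) < snd (e k))"

text \<open>At most one summand is nonzero, since the \<open>e k\<close> are distinct and increasing pairs.\<close>
definition M_mat :: "nat \<Rightarrow> (nat \<Rightarrow> nat \<times> nat) \<Rightarrow> real vec \<Rightarrow> real mat" where
  "M_mat n e x = mat n n (\<lambda>(i, j). \<Sum>k<n - 1.
     if (i, j) = e k then x $ k else if (j, i) = e k then - (x $ k) else 0)"

definition N_mat :: "nat \<Rightarrow> (nat \<Rightarrow> nat \<times> nat) \<Rightarrow> real vec \<Rightarrow> real mat" where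
  "N_mat n e x = mat_delete (M_mat n e x) (n - 1) (n - 1)"

definition trace_mat :: "real mat \<Rightarrow> real" where
  "trace_mat B = (\<Sum>i<dim_row B. B $$ (i, i))"

text \<open>The traces of powers of \<open>M\<close> run over exponents \<open>2, 4, \<dots>, 2m\<close> with \<open>m = n div 2\<close>.  Those of
  \<open>N\<close> run up to \<open>2(m - 1)\<close> if \<open>n = 2m\<close> and up to \<open>2m\<close> if \<open>n = 2m + 1\<close>, that is, up to
  \<open>2((n - 1) div 2)\<close> in both cases.\<close>
definition f_map :: "nat \<Rightarrow> (nat \<Rightarrow> nat \<times> nat) \<Rightarrow> real vec \<Rightarrow> real vec" where
  "f_map n e x = vec_of_list
     (map (\<lambda>r. trace_mat (M_mat n e x ^\<^sub>m (2 * r)) / (4 * real r)) [1..<Suc (n div 2)] @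
      map (\<lambda>r. trace_mat (N_mat n e x ^\<^sub>m (2 * r)) / (4 * real r)) [1..<Suc ((n - 1) div 2)])"

definition jacobian_mat :: "(real vec \<Rightarrow> real vec) \<Rightarrow> real vec \<Rightarrow> real mat" where
  "jacobian_mat f x = mat (dim_vec (f x)) (dim_vec x)
     (\<lambda>(r, c). deriv (\<lambda>t. f (update_vec x c t) $ r) (x $ c))"

end

theory Submission
  imports Defs "Jordan_Normal_Form.Schur_Decomposition"
begin

text \<open>The row of the Jacobian matrix at \<open>A\<close> belonging to \<open>tr M\<^sup>2\<^sup>r / 4r\<close> consists of the edge
  entries of \<open>- A\<^sup>2\<^sup>r\<^sup>-\<^sup>1\<close>, and likewise for \<open>N\<close> with \<open>B = A(n)\<close>.  So a linear dependence between the
  rows gives odd polynomials \<open>p, q\<close> such that the skew-symmetric matrix \<open>X = p(A) + (q(B) \<oplus> 0)\<close>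
  vanishes on all edges, while the commutator \<open>[A, X]\<close> vanishes outside row and column \<open>n\<close>.
  The Duarte property forces \<open>X = 0\<close>: by induction over the branches at \<open>w\<close> the diagonal blocks of
  \<open>X\<close> vanish, then row and column \<open>w\<close> do, and then \<open>X\<close> commutes with \<open>A(w)\<close>, which is block
  diagonal with distinct eigenvalues, so the remaining blocks vanish too.
  Finally, \<open>p(A)\<close> has zero last column. Strict interlacing makes the last entry of every left
  eigenvector of \<open>A\<close> nonzero, so \<open>p\<close> vanishes at \<open>n\<close> distinct eigenvalues and hence is \<open>0\<close>, and then
  \<open>q\<close> vanishes at the \<open>n - 1\<close> distinct eigenvalues of \<open>B\<close> and is \<open>0\<close> as well.\<close>

subsection \<open>Spectra and commutants\<close>

text \<open>An odd polynomial with \<open>k\<close> coefficients has degree at most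
  \<open>2 * k - 1\<close>, so \<open>2 * k\<close> distinct roots force it to vanish.\<close>

lemma odd_poly_coeffs_zero:
  fixes a :: "nat \<Rightarrow> complex"
  assumes "finite L" "2 * k \<le> card L" "\<And>z. z \<in> L \<Longrightarrow> (\<Sum>r<k. a r * z ^ (2 * r + 1)) = 0" "r < k"
  shows "a r = 0"
proof -
  define P where "P = (\<Sum>r<k. monom (a r) (2 * r + 1))"
  have "degree P \<le> 2 * k - 1"
    unfolding P_def by (rule degree_sum_le) (auto intro!: order.trans[OF degree_monom_le])
  hence deg: "degree P < 2 * k" using \<open>r < k\<close> by linarith
  have "L \<subseteq> {z. poly P z = 0}" using assms(3) by (auto simp: P_def poly_sum poly_monom)
  hence "P = 0" using card_mono[of "{z. poly P z = 0}" L] card_poly_roots_bound[of P]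
      poly_roots_finite[of P] deg assms(2) by fastforce
  moreover have "coeff P (2 * r + 1) = (\<Sum>r'<k. if r' = r then a r' else 0)"
    unfolding P_def coeff_sum by (intro sum.cong) auto
  ultimately show ?thesis using \<open>r < k\<close> by simp
qed

text \<open>The characteristic polynomial is monic and splits over the complex numbers; its root
  list therefore yields the linear factorization that the Schur decomposition asks for.\<close>

lemma spectrum_listD:
  assumes B: "B \<in> carrier_mat n n" and ls: "spectrum_list B ls"
  defines "C \<equiv> map_mat complex_of_real B"
  shows "length ls = n" "set ls = {z. eigenvalue C z}" "char_poly C = (\<Prod>a\<leftarrow>ls. [:- a, 1:])"
proof -
  have C: "C \<in> carrier_mat n n" using B by (simp add: C_def)
  have m: "mset ls = proots (char_poly C)" using ls by (simp add: spectrum_list_def C_def)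
  have nz: "char_poly C \<noteq> 0" and lc: "lead_coeff (char_poly C) = 1"
    and deg: "degree (char_poly C) = n"
    using degree_monic_char_poly[OF C] by auto
  show "length ls = n" using size_proots_complex[of "char_poly C"] deg
    unfolding m[symmetric] by simp
  show "set ls = {z. eigenvalue C z}"
    using nz by (simp add: eigenvalue_root_char_poly[OF C] m set_mset_mset[symmetric] del: set_mset_mset)
  show "char_poly C = (\<Prod>a\<leftarrow>ls. [:- a, 1:])"
    using complex_poly_decompose_multiset[of "char_poly C"] unfolding m[symmetric] lc smult_1_left
    by (metis mset_map prod_mset_prod_list)
qed

lemma strictly_interlacesD:
  assumes "strictly_interlaces ms ls" "sorted_wrt imag_le ls"
  shows "distinct ms" "distinct ls" "set ms \<inter> set ls = {}"
proof -
  \<comment> \<open>\<open>f\<close> is the imaginary part, so the order on the imaginary axis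
    becomes that of the reals; distinctness follows because \<open>f\<close> increases strictly
    along both lists.\<close>
  define f where "f z = Re (- \<i> * z)" for z
  have len: "length ls = Suc (length ms)"
    and l: "f (ls ! i) < f (ms ! i)" and u: "f (ms ! i) < f (ls ! Suc i)"
    if "i < length ms" for i
    using assms(1) that by (auto simp: strictly_interlaces_def imag_less_def f_def)
  have mono: "f (ls ! i) \<le> f (ls ! j)" if "i \<le> j" "j < length ls" for i j
    using assms(2) that by (cases "i = j") (auto simp: sorted_wrt_iff_nth_less imag_le_def f_def)
  have ml: "f (ls ! i) < f (ms ! j)" if "i \<le> j" "j < length ms" for i j
    using mono[of i j] l[of j] that len by fastforce
  have mu: "f (ms ! j) < f (ls ! i)" if "j < i" "i < length ls" for i j
    using mono[of "Suc j" i] u[of j] that len assms(1)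
    by (fastforce simp: strictly_interlaces_def)
  have len': "length ls = Suc (length ms)" using assms(1) by (simp add: strictly_interlaces_def)
  have d1: "f (ms ! i) < f (ms ! j)" if "i < j" "j < length ms" for i j
    using mu[of i j] l[of j] that len' by fastforce
  have d2: "f (ls ! i) < f (ls ! j)" if "i < j" "j < length ls" for i j
    using mu[of i j] l[of i] that len' by fastforce
  show "distinct ms" unfolding distinct_conv_nth using d1 by (metis less_irrefl linorder_neqE_nat)
  show "distinct ls" unfolding distinct_conv_nth using d2 by (metis less_irrefl linorder_neqE_nat)
  have "ms ! j \<noteq> ls ! i" if "j < length ms" "i < length ls" for i j
    using ml[of i j] mu[of j i] that by (metis less_irrefl not_less)
  thus "set ms \<inter> set ls = {}" by (fastforce simp: in_set_conv_nth)
qed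

text \<open>Induction over the diagonals, starting in the lower left corner. Once all lower
  diagonals of \<open>Z\<close> vanish, entry \<open>(r, c)\<close> of \<open>B * Z = Z * B\<close>
  involves no entry of \<open>Z\<close> except \<open>Z $$ (r, c)\<close>, multiplied by diagonal
  entries of \<open>B\<close>. Their distinctness settles \<open>r \<noteq> c\<close>; for
  \<open>r = c\<close> the square of the entry is an entry of \<open>Z * Z\<close>.\<close>

lemma upper_triangular_commute_nilpotent:
  fixes B Z :: "'a :: idom mat"
  assumes B: "B \<in> carrier_mat n n" and Z: "Z \<in> carrier_mat n n"
    and ut: "upper_triangular B" and dist: "distinct (diag_mat B)"
    and comm: "B * Z = Z * B" and nil: "Z * Z = 0\<^sub>m n n"
  shows "Z = 0\<^sub>m n n"
proof -
  have "Z $$ (r, c) = 0" if "r < n" "c < n" for r c using that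
  \<comment> \<open>The summand \<open>n\<close> keeps the natural subtraction from truncating, as
    \<open>r < n\<close>.\<close>
  proof (induction "n + c - r" arbitrary: r c rule: less_induct)
    case less
    have IH: "Z $$ (r', c') = 0" if "r' < n" "c' < n" "n + c' - r' < n + c - r" for r' c'
      using less.hyps that by blast
    have ij: "B $$ (i, j) = 0" if "j < i" "i < n" for i j
      using ut B that by (auto simp: upper_triangular_def)
    have "(B * Z) $$ (r, c) = (\<Sum>k\<in>{0..<n}. B $$ (r, k) * Z $$ (k, c))"
      using B Z less.prems by (auto simp: scalar_prod_def)
    also have "\<dots> = (\<Sum>k\<in>{r}. B $$ (r, k) * Z $$ (k, c))"
      using less.prems IH ij by (intro sum.mono_neutral_right) (auto simp: nat_neq_iff)
    finally have 1: "(B * Z) $$ (r, c) = B $$ (r, r) * Z $$ (r, c)" by simp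
    have "(Z * B) $$ (r, c) = (\<Sum>k\<in>{0..<n}. Z $$ (r, k) * B $$ (k, c))"
      using B Z less.prems by (auto simp: scalar_prod_def)
    also have "\<dots> = (\<Sum>k\<in>{c}. Z $$ (r, k) * B $$ (k, c))"
      using less.prems IH ij by (intro sum.mono_neutral_right) (auto simp: nat_neq_iff)
    finally have 2: "(Z * B) $$ (r, c) = Z $$ (r, c) * B $$ (c, c)" by simp
    have 3: "(B $$ (r, r) - B $$ (c, c)) * Z $$ (r, c) = 0"
      using 1[unfolded comm 2] by (auto simp: left_diff_distrib mult.commute)
    show ?case
    proof (cases "r = c")
      case False
      hence "B $$ (r, r) \<noteq> B $$ (c, c)"
        using dist less.prems B by (auto simp: diag_mat_def distinct_map inj_on_def)
      thus ?thesis using 3 by simp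
    next
      case True
      have "(Z * Z) $$ (r, r) = (\<Sum>k\<in>{0..<n}. Z $$ (r, k) * Z $$ (k, r))"
        using Z less.prems by (auto simp: scalar_prod_def)
      also have "\<dots> = (\<Sum>k\<in>{r}. Z $$ (r, k) * Z $$ (k, r))"
        using less.prems IH True by (intro sum.mono_neutral_right) (auto simp: nat_neq_iff)
      finally show ?thesis using nil less.prems True by simp
    qed
  qed
  thus ?thesis using Z by (intro eq_matI) auto
qed

text \<open>The Schur decomposition makes \<open>A\<close> upper triangular with \<open>ls\<close>
  on the diagonal; conjugating \<open>Z\<close> in the same way preserves both the commutation and
  \<open>Z * Z = 0\<close>.\<close>

lemma commute_nilpotent_zero:
  fixes A Z :: "complex mat"
  assumes A: "A \<in> carrier_mat n n" and Z: "Z \<in> carrier_mat n n"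
    and cp: "char_poly A = (\<Prod>a\<leftarrow>ls. [:- a, 1:])" and dist: "distinct ls"
    and comm: "A * Z = Z * A" and nil: "Z * Z = 0\<^sub>m n n"
  shows "Z = 0\<^sub>m n n"
proof -
  obtain B P Q where "schur_decomposition A ls = (B, P, Q)"
    by (metis prod_cases3)
  from schur_decomposition[OF A cp this]
  have w: "similar_mat_wit A B P Q" and ut: "upper_triangular B" and d: "diag_mat B = ls" by auto
  note s = similar_mat_witD2[OF A w]
  define Y where "Y = Q * Z * P"
  have Y: "Y \<in> carrier_mat n n" using s Z by (auto simp: Y_def)
  have as: "(X * V) * W = X * (V * W)" if "X \<in> carrier_mat n n" "V \<in> carrier_mat n n" "W \<in> carrier_mat n n"
    for X V W :: "complex mat" using that by (rule assoc_mult_mat)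
  note c = s(4-7) Z mult_carrier_mat[of _ n n _ n]
  have ZY: "Z = P * Y * Q"
  proof -
    have "P * Y * Q = (P * Q) * Z * (P * Q)" by (simp add: Y_def as c del: s(1))
    thus ?thesis using Z by (simp add: s(1))
  qed
  \<comment> \<open>In right-nested products the inverse factors meet only in front of a remainder
    \<open>X\<close>, so the cancellation rules are stated in that form.\<close>
  have QP: "Q * (P * X) = X" if "X \<in> carrier_mat n n" for X
    using as[of Q P X] s that by simp
  have PQ: "P * (Q * X) = X" if "X \<in> carrier_mat n n" for X
    using as[of P Q X] s that by simp
  have "B * Y = Q * (A * Z) * P"
    by (simp add: s(3) Y_def as c QP)
  also have "\<dots> = Y * B" unfolding comm
    by (simp add: s(3) Y_def as c QP s(2) right_mult_one_mat[OF s(5)])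
  finally have BY: "B * Y = Y * B" .
  have "Y * Y = Q * (Z * Z) * P"
    by (simp add: Y_def as c PQ)
  hence YY: "Y * Y = 0\<^sub>m n n" unfolding nil using s(6,7) by simp
  have "Y = 0\<^sub>m n n"
    by (rule upper_triangular_commute_nilpotent[OF s(5) Y ut _ BY YY]) (simp only: d dist)
  hence "Z = P * 0\<^sub>m n n * Q" using ZY by simp
  thus ?thesis using s(6,7) by simp
qed

subsection \<open>Branches of trees\<close>

text \<open>The walk is kept simple while it grows: a step to a vertex already visited cuts the list
  there, any other step appends. Such a path closes to a cycle when a common neighbour of its ends
  is added.\<close>

lemma simple_path_exists:
  assumes "(u, v) \<in> r\<^sup>*" "u \<noteq> v"
  shows "\<exists>vs. distinct vs \<and> 2 \<le> length vs \<and> hd vs = u \<and> last vs = v \<and> successively (\<lambda>x y. (x, y) \<in> r) vs"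
proof -
  have "\<exists>vs. distinct vs \<and> vs \<noteq> [] \<and> hd vs = u \<and> last vs = v \<and> successively (\<lambda>x y. (x, y) \<in> r) vs"
    using assms(1)
  proof (induction rule: rtrancl_induct)
    case base
    show ?case by (rule exI[of _ "[u]"]) simp
  next
    case (step y z)
    then obtain vs where vs: "distinct vs" "vs \<noteq> []" "hd vs = u" "last vs = y"
      "successively (\<lambda>x y. (x, y) \<in> r) vs" by blast
    show ?case
    proof (cases "z \<in> set vs")
      case True
      then obtain as bs where "vs = as @ z # bs" by (meson split_list)
      with vs show ?thesis
        by (intro exI[of _ "as @ [z]"]) (auto simp: successively_append_iff hd_append)
    next
      case False
      with vs step(2) show ?thesis
        by (intro exI[of _ "vs @ [z]"]) (auto simp: successively_append_iff)
    qed
  qed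
  then obtain vs where vs: "distinct vs" "vs \<noteq> []" "hd vs = u" "last vs = v"
    "successively (\<lambda>x y. (x, y) \<in> r) vs" by blast
  moreover have "2 \<le> length vs" using vs assms(2)
    by (cases vs; cases "tl vs") auto
  ultimately show ?thesis by blast
qed

lemma branch_verts_subset:
  assumes "v \<in> S" "v \<noteq> w"
  shows "branch_verts (induced G S) w v \<subseteq> S - {w}"
proof
  fix u assume "u \<in> branch_verts (induced G S) w v"
  hence "(v, u) \<in> (adj (delete_vertex (induced G S) w))\<^sup>*" by (simp add: branch_verts_def)
  thus "u \<in> S - {w}"
    by (induction rule: rtrancl_induct)
      (use assms in \<open>auto simp: adj_def delete_vertex_def induced_def\<close>)
qed

lemma root_in_branch_verts: "v \<in> branch_verts G w v"
  by (simp add: branch_verts_def)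

lemma branch_verts_closed:
  assumes "x \<in> branch_verts (induced G S) w v" "{x, y} \<in> edges G" "x \<in> S - {w}" "y \<in> S - {w}"
  shows "y \<in> branch_verts (induced G S) w v"
proof -
  have "(x, y) \<in> adj (delete_vertex (induced G S) w)"
    using assms(2-4) by (auto simp: adj_def delete_vertex_def induced_def)
  thus ?thesis using assms(1) by (auto simp: branch_verts_def intro: rtrancl_into_rtrancl)
qed

text \<open>Two neighbours of \<open>w\<close> in the same branch would close a cycle through \<open>w\<close>.\<close>
lemma branch_verts_unique_neighbour:
  assumes acyc: "\<not> (\<exists>vs. is_cycle G vs)"
    and "{w, v} \<in> edges G" "{w, x} \<in> edges G" "v \<in> S" "v \<noteq> w"
    and x: "x \<in> branch_verts (induced G S) w v"
  shows "x = v"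
proof (rule ccontr)
  assume "x \<noteq> v"
  let ?r = "adj (delete_vertex (induced G S) w)"
  have "(v, x) \<in> ?r\<^sup>*" using x by (simp add: branch_verts_def)
  from simple_path_exists[OF this] \<open>x \<noteq> v\<close> obtain vs where vs: "distinct vs" "2 \<le> length vs"
    "hd vs = v" "last vs = x" "successively (\<lambda>x y. (x, y) \<in> ?r) vs" by metis
  have e: "{vs ! i, vs ! Suc i} \<in> edges G" "vs ! i \<noteq> w" "vs ! Suc i \<noteq> w"
    if "Suc i < length vs" for i
    using successively_nth[OF vs(5) that] by (auto simp: adj_def delete_vertex_def induced_def)
  \<comment> \<open>Having at least two vertices, the path has each of its vertices on one of its
    edges, and these avoid \<open>w\<close>.\<close>
  have "w \<notin> set vs"
  proof
    assume "w \<in> set vs"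
    then obtain i where "i < length vs" "vs ! i = w" by (auto simp: in_set_conv_nth)
    thus False using e(3)[of "i - 1"] e(2)[of 0] vs(2) by (cases i) auto
  qed
  moreover have "{(w # vs) ! i, (w # vs) ! (Suc i mod length (w # vs))} \<in> edges G"
    if i: "i < length (w # vs)" for i
  proof -
    \<comment> \<open>The three cases are the edge from \<open>w\<close> to \<open>v\<close>, the
      edges of the path, and the closing edge from \<open>x\<close>, where the index wraps around to
      \<open>w\<close>.\<close>
    consider "i = 0" | j where "i = Suc j" "Suc j < length vs" | "i = length vs"
      using i by (cases i) (auto simp: less_Suc_eq)
    thus ?thesis
    proof cases
      case 1
      thus ?thesis using assms(2) vs(2,3) by (cases vs) auto
    next
      case 2
      thus ?thesis using e(1) by simp
    next
      case 3
      thus ?thesis using assms(3) vs(2,4)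
        by (cases vs rule: rev_cases) (auto simp: insert_commute nth_append)
    qed
  qed
  ultimately have "is_cycle G (w # vs)" using vs by (simp add: is_cycle_def)
  thus False using acyc by blast
qed

text \<open>Along a walk from \<open>w\<close>, a step out of \<open>w\<close> enters a branch at
  its root, and a step between vertices other than \<open>w\<close> stays in the same
  branch.\<close>

lemma branch_verts_cover:
  assumes reach: "(w, u) \<in> (adj (induced G S))\<^sup>*" and "u \<noteq> w"
  shows "\<exists>v. {w, v} \<in> edges (induced G S) \<and> u \<in> branch_verts (induced G S) w v"
  using reach \<open>u \<noteq> w\<close>
proof (induction rule: rtrancl_induct)
  case base
  thus ?case by simp
next
  case (step y z)
  show ?case
  proof (cases "y = w")
    case True
    thus ?thesis using step(2) by (auto simp: adj_def branch_verts_def)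
  next
    case False
    with step obtain v where v: "{w, v} \<in> edges (induced G S)"
      "y \<in> branch_verts (induced G S) w v" by blast
    have "{y, z} \<in> edges G" "y \<in> S - {w}" "z \<in> S - {w}"
      using step False by (auto simp: adj_def induced_def)
    thus ?thesis using branch_verts_closed[OF v(2)] v(1) by blast
  qed
qed

text \<open>All vertices of a walk from \<open>v\<close> avoiding \<open>w\<close> belong to the
  branch, so the walk survives in the induced subgraph. This provides the reachability assumption
  when recursing into a branch.\<close>

lemma branch_connected:
  assumes "u \<in> branch_verts (induced G S) w v"
  shows "(v, u) \<in> (adj (induced G (branch_verts (induced G S) w v)))\<^sup>*"
proof -
  let ?r = "adj (delete_vertex (induced G S) w)"
  have "(v, u) \<in> ?r\<^sup>*" using assms by (simp add: branch_verts_def)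
  thus ?thesis
  proof (induction rule: rtrancl_induct)
    case (step y z)
    have "y \<in> branch_verts (induced G S) w v" "z \<in> branch_verts (induced G S) w v"
      using step(1,2) by (auto simp: branch_verts_def)
    hence "(y, z) \<in> adj (induced G (branch_verts (induced G S) w v))"
      using step(2) by (auto simp: adj_def induced_def delete_vertex_def)
    thus ?case using step(3) by (rule rtrancl_into_rtrancl[rotated])
  qed simp
qed

subsection \<open>The Duarte property and commutators\<close>

text \<open>Translates sums over positions in a principal submatrix into sums over its vertex
  labels.\<close>

lemma bij_betw_pick:
  assumes "finite S"
  shows "bij_betw (pick S) {0..<card S} S"
proof (rule bij_betw_imageI)
  show inj: "inj_on (pick S) {0..<card S}"
  proof (rule inj_onI)
    fix x y assume "x \<in> {0..<card S}" "y \<in> {0..<card S}" "pick S x = pick S y"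
    thus "x = y" using pick_mono_le[of x S y] pick_mono_le[of y S x]
      by (metis atLeastLessThan_iff less_irrefl linorder_neqE_nat)
  qed
  have "pick S ` {0..<card S} \<subseteq> S" using pick_in_set_le by auto
  thus "pick S ` {0..<card S} = S"
    using assms card_image[OF inj] by (intro card_subset_eq) auto
qed

text \<open>The off-diagonal block of \<open>X\<close> is nilpotent and commutes with a matrix whose
  eigenvalues are distinct, so it vanishes.\<close>
lemma commuting_off_diagonal_block_zero:
  fixes X :: "nat \<Rightarrow> nat \<Rightarrow> real"
  assumes A: "A \<in> carrier_mat n n" and S: "S \<subseteq> {..<n}"
    and spec: "spectrum_list (submatrix A S S) ms" "distinct ms"
    and blk: "\<And>i k. i \<in> C \<Longrightarrow> k \<in> S - C \<Longrightarrow> A $$ (i, k) = 0 \<and> A $$ (k, i) = 0"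
    and comm: "\<And>i j. i \<in> S \<Longrightarrow> j \<in> S \<Longrightarrow>
      (\<Sum>k\<in>S. A $$ (i, k) * X k j) = (\<Sum>k\<in>S. X i k * A $$ (k, j))"
    and ij: "i \<in> C" "i \<in> S" "j \<in> S - C"
  shows "X i j = 0"
proof -
  have fin: "finite S" using S by (rule finite_subset) simp
  \<comment> \<open>\<open>F\<close> is the block of \<open>X\<close> with rows in \<open>C\<close>
    and columns outside \<open>C\<close>, padded by zeros; consecutive factors \<open>F x k\<close>
    and \<open>F k y\<close> would need \<open>k\<close> both outside and inside \<open>C\<close>,
    so it squares to zero.\<close>
  define F where "F x y = (if x \<in> C \<and> y \<notin> C then X x y else 0)" for x y
  \<comment> \<open>As \<open>A\<close> has no entries linking \<open>C\<close> to the rest of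
    \<open>S\<close>, the commutator with \<open>F\<close> is just the corresponding block of the
    commutator with \<open>X\<close>.\<close>
  have F: "(\<Sum>k\<in>S. A $$ (x, k) * F k y) = (\<Sum>k\<in>S. F x k * A $$ (k, y))"
    if xy: "x \<in> S" "y \<in> S" for x y
  proof (cases "x \<in> C \<and> y \<notin> C")
    case True
    have "(\<Sum>k\<in>S. A $$ (x, k) * F k y) = (\<Sum>k\<in>S. A $$ (x, k) * X k y)"
      using True blk[of x] by (intro sum.cong) (auto simp: F_def)
    moreover have "(\<Sum>k\<in>S. F x k * A $$ (k, y)) = (\<Sum>k\<in>S. X x k * A $$ (k, y))"
      using True blk[of _ y] xy by (intro sum.cong) (auto simp: F_def)
    ultimately show ?thesis using comm[OF xy] by simp
  next
    case False
    have "A $$ (x, k) * F k y = 0" "F x k * A $$ (k, y) = 0" if "k \<in> S" for k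
      using False blk[of k x] blk[of y k] xy that by (auto simp: F_def)
    thus ?thesis by simp
  qed
  let ?m = "card S" and ?p = "pick S"
  have "{i. i < n \<and> i \<in> S} = S" using S by auto
  hence carr: "submatrix A S S \<in> carrier_mat ?m ?m"
    and idx: "\<And>a b. a < ?m \<Longrightarrow> b < ?m \<Longrightarrow> submatrix A S S $$ (a, b) = A $$ (?p a, ?p b)"
    using A by (simp_all add: submatrix_def)
  define B where "B = map_mat complex_of_real (submatrix A S S)"
  \<comment> \<open>\<open>F\<close> is renumbered along \<open>pick\<close> and made complex, to
    match the eigenvalue setting of the submatrix.\<close>
  define Z where "Z = mat ?m ?m (\<lambda>(a, b). complex_of_real (F (?p a) (?p b)))"
  have B: "B \<in> carrier_mat ?m ?m" and Z: "Z \<in> carrier_mat ?m ?m" using carr by (auto simp: B_def Z_def)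
  have bij: "bij_betw ?p {0..<?m} S" by (rule bij_betw_pick[OF fin])
  hence pS: "?p a \<in> S" if "a < ?m" for a using that by (auto dest: bij_betwE)
  have re: "(\<Sum>k\<in>{0..<?m}. h (?p k)) = (\<Sum>k\<in>S. h k)" for h :: "nat \<Rightarrow> real"
    by (rule sum.reindex_bij_betw[OF bij])
  have "B * Z = Z * B"
  proof (rule eq_matI)
    fix a b assume "a < dim_row (Z * B)" "b < dim_col (Z * B)"
    hence ab: "a < ?m" "b < ?m" using B Z by auto
    have "(B * Z) $$ (a, b) = (\<Sum>k\<in>{0..<?m}. complex_of_real (A $$ (?p a, ?p k) * F (?p k) (?p b)))"
      using ab B carr by (simp add: B_def Z_def scalar_prod_def idx)
    also have "\<dots> = complex_of_real (\<Sum>k\<in>S. F (?p a) k * A $$ (k, ?p b))"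
      unfolding of_real_sum[symmetric] re[of "\<lambda>k. A $$ (?p a, k) * F k (?p b)"]
        F[OF pS[OF ab(1)] pS[OF ab(2)]] ..
    also have "\<dots> = (\<Sum>k\<in>{0..<?m}. complex_of_real (F (?p a) (?p k) * A $$ (?p k, ?p b)))"
      unfolding of_real_sum[symmetric] re[of "\<lambda>k. F (?p a) k * A $$ (k, ?p b)"] ..
    also have "\<dots> = (Z * B) $$ (a, b)"
      using ab B carr by (simp add: B_def Z_def scalar_prod_def idx)
    finally show "(B * Z) $$ (a, b) = (Z * B) $$ (a, b)" .
  qed (use B Z in auto)
  moreover have "Z * Z = 0\<^sub>m ?m ?m"
  proof (rule eq_matI)
    fix a b assume "a < dim_row (0\<^sub>m ?m ?m :: complex mat)" "b < dim_col (0\<^sub>m ?m ?m :: complex mat)"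
    hence ab: "a < ?m" "b < ?m" by simp_all
    have "F (?p a) k * F k (?p b) = 0" for k by (simp add: F_def)
    thus "(Z * Z) $$ (a, b) = 0\<^sub>m ?m ?m $$ (a, b)"
      using ab by (simp add: Z_def scalar_prod_def flip: of_real_mult)
  qed (use Z in simp_all)
  ultimately have "Z = 0\<^sub>m ?m ?m"
    using commute_nilpotent_zero[OF B Z spectrum_listD(3)[OF carr spec(1), folded B_def] spec(2)]
    by blast
  moreover have "i \<in> ?p ` {0..<?m}" "j \<in> ?p ` {0..<?m}"
    using bij_betw_imp_surj_on[OF bij] ij by simp_all
  then obtain a b where ab: "a < ?m" "i = ?p a" "b < ?m" "j = ?p b" by auto
  moreover have "Z $$ (a, b) = complex_of_real (F i j)" using ab by (simp add: Z_def)
  ultimately have "F i j = 0" by simp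
  thus ?thesis using ij by (simp add: F_def)
qed

text \<open>The graph reads only the entries above the diagonal; skew-symmetry covers those below
  and makes the diagonal zero, matching the absence of loops.\<close>

lemma edge_graph_of_iff:
  assumes A: "A \<in> carrier_mat n n" and skew: "\<And>i j. i < n \<Longrightarrow> j < n \<Longrightarrow> A $$ (j, i) = - A $$ (i, j)"
    and ij: "i < n" "j < n"
  shows "{i, j} \<in> edges (graph_of A) \<longleftrightarrow> A $$ (i, j) \<noteq> 0"
proof -
  have *: "{i, j} \<in> edges (graph_of A) \<longleftrightarrow> A $$ (i, j) \<noteq> 0" if "i < j" "j < n" for i j
    using A that by (auto simp: graph_of_def doubleton_eq_iff)
  show ?thesis
  proof (cases i j rule: linorder_cases)
    case equal
    thus ?thesis using skew[of i i] ij by (auto simp: graph_of_def doubleton_eq_iff)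
  next
    case greater
    thus ?thesis using *[of j i] skew[of i j] ij by (simp add: insert_commute)
  qed (use * ij in simp)
qed

text \<open>Leaving row and column \<open>w\<close> out of the commutator condition is what makes
  the induction work: a branch meets the rest of \<open>S\<close> only at its root, so it inherits
  the condition with the root left out. Taking \<open>X\<close> as a function on labels avoids
  renumbering for branches.\<close>

lemma duarte_on_commutator_zero:
  fixes X :: "nat \<Rightarrow> nat \<Rightarrow> real"
  assumes A: "A \<in> carrier_mat n n" and skew: "\<And>i j. i < n \<Longrightarrow> j < n \<Longrightarrow> A $$ (j, i) = - A $$ (i, j)"
    and acyc: "\<not> (\<exists>vs. is_cycle (graph_of A) vs)"
    and diag: "\<And>i. i < n \<Longrightarrow> X i i = 0"
    and zero: "\<And>i j. i < n \<Longrightarrow> j < n \<Longrightarrow> A $$ (i, j) \<noteq> 0 \<Longrightarrow> X i j = 0"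
    and "duarte_on A S w" "S \<subseteq> {..<n}"
    and "\<And>u. u \<in> S \<Longrightarrow> (w, u) \<in> (adj (induced (graph_of A) S))\<^sup>*"
    and "\<And>i j. i \<in> S - {w} \<Longrightarrow> j \<in> S - {w} \<Longrightarrow>
      (\<Sum>k\<in>S. A $$ (i, k) * X k j) = (\<Sum>k\<in>S. X i k * A $$ (k, j))"
  shows "\<forall>i\<in>S. \<forall>j\<in>S. X i j = 0"
  using assms(6-)
proof (induction rule: duarte_on.induct)
  case (duarte_single w)
  thus ?case using diag by simp
next
  case (duarte_step w S)
  let ?G = "graph_of A"
  define C where "C v = branch_verts (induced ?G S) w v" for v
  define N where "N v \<longleftrightarrow> {w, v} \<in> edges (induced ?G S)" for v
  note S = \<open>S \<subseteq> {..<n}\<close>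
  have fin: "finite S" using S by (rule finite_subset) simp
  have edge: "{i, j} \<in> edges ?G \<longleftrightarrow> A $$ (i, j) \<noteq> 0" if "i < n" "j < n" for i j
    by (rule edge_graph_of_iff[OF A skew that])
  have N: "v \<in> S" "v \<noteq> w" "{w, v} \<in> edges ?G" "A $$ (w, v) \<noteq> 0" "A $$ (v, w) \<noteq> 0" if "N v" for v
  proof -
    show v: "v \<in> S" and e: "{w, v} \<in> edges ?G" using that by (auto simp: N_def induced_def)
    show "v \<noteq> w" using e by (auto simp: graph_of_def doubleton_eq_iff)
    show "A $$ (w, v) \<noteq> 0" "A $$ (v, w) \<noteq> 0"
      using e v edge[of w v] edge[of v w] S duarte_step.hyps(1) by (auto simp: insert_commute)
  qed
  have CS: "C v \<subseteq> S - {w}" if "N v" for v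
    unfolding C_def using N[OF that] by (intro branch_verts_subset)
  \<comment> \<open>Acyclicity enters here: the only edge of \<open>S\<close> leaving the branch
    \<open>C v\<close> joins its root \<open>v\<close> to \<open>w\<close>.\<close>
  have nb: "k \<in> C v \<or> k = w \<and> x = v"
    if v: "N v" and x: "x \<in> C v" and k: "k \<in> S" "A $$ (x, k) \<noteq> 0 \<or> A $$ (k, x) \<noteq> 0" for v x k
  proof -
    have xS: "x \<in> S - {w}" using CS[OF v] x by auto
    have e: "{x, k} \<in> edges ?G" using edge[of x k] edge[of k x] xS k S by (auto simp: insert_commute)
    show ?thesis
    proof (cases "k = w")
      case True
      thus ?thesis using branch_verts_unique_neighbour[OF acyc N(3)[OF v] _ N(1,2)[OF v]] e x
        by (auto simp: C_def insert_commute)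
    next
      case False
      thus ?thesis using branch_verts_closed[of x ?G S w v k] e x xS k by (auto simp: C_def)
    qed
  qed
  have cover: "\<exists>v. N v \<and> u \<in> C v" if "u \<in> S - {w}" for u
    using branch_verts_cover[OF duarte_step.prems(2), of u] that by (auto simp: N_def C_def)
  have XC: "X i j = 0" if v: "N v" and ij: "i \<in> C v" "j \<in> C v" for v i j
  proof -
    have "\<forall>i\<in>C v. \<forall>j\<in>C v. X i j = 0" unfolding C_def
    proof (rule duarte_step.IH[OF v[unfolded N_def]], fold C_def)
      show "C v \<subseteq> {..<n}" using CS[OF v] S by auto
      show "(v, u) \<in> (adj (induced ?G (C v)))\<^sup>*" if "u \<in> C v" for u
        using branch_connected that unfolding C_def by fast
      fix i j assume ij: "i \<in> C v - {v}" "j \<in> C v - {v}"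
      \<comment> \<open>Since \<open>i\<close> and \<open>j\<close> are not the root, row
        \<open>i\<close> and column \<open>j\<close> of \<open>A\<close> have no nonzero entries at
        indices in \<open>S\<close> outside the branch, and both sums may range over all of
        \<open>S\<close>.\<close>
      have "(\<Sum>k\<in>C v. A $$ (i, k) * X k j) = (\<Sum>k\<in>S. A $$ (i, k) * X k j)"
        using nb[OF v, of i] ij CS[OF v] fin by (intro sum.mono_neutral_left) auto
      also have "\<dots> = (\<Sum>k\<in>S. X i k * A $$ (k, j))"
        using ij CS[OF v] by (intro duarte_step.prems(3)) auto
      also have "\<dots> = (\<Sum>k\<in>C v. X i k * A $$ (k, j))"
        using nb[OF v, of j] ij CS[OF v] fin by (intro sum.mono_neutral_right) auto
      finally show "(\<Sum>k\<in>C v. A $$ (i, k) * X k j) = (\<Sum>k\<in>C v. X i k * A $$ (k, j))" .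
    qed
    thus ?thesis using ij by blast
  qed
  have wn: "w < n" and wS: "w \<in> S" using S duarte_step.hyps(1) by auto
  \<comment> \<open>At position \<open>(v, j)\<close> of the commutator everything cancels except
    \<open>A $$ (v, w) * X w j\<close>: the block on \<open>C v\<close> is zero, and so is
    \<open>X\<close> on the edge between \<open>v\<close> and \<open>w\<close>. Position
    \<open>(j, v)\<close> gives the mirrored entry.\<close>
  have Xw': "X w j = 0 \<and> X j w = 0" if v: "N v" and j: "j \<in> C v" for v j
  proof -
    have vC: "v \<in> C v" by (simp add: C_def root_in_branch_verts)
    have vn: "v < n" using N(1)[OF v] S by auto
    have Xvw: "X v w = 0" "X w v = 0" using zero vn wn N(4,5)[OF v] by auto
    have jv: "j \<in> S - {w}" "v \<in> S - {w}" using CS[OF v] j vC by auto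
    have "(\<Sum>k\<in>S. A $$ (v, k) * X k j) = (\<Sum>k\<in>{w}. A $$ (v, k) * X k j)"
      using nb[OF v vC] XC[OF v _ j] wS fin by (intro sum.mono_neutral_right) auto
    moreover have "(\<Sum>k\<in>S. X v k * A $$ (k, j)) = 0"
      using nb[OF v j] XC[OF v vC] Xvw by (intro sum.neutral) auto
    ultimately have 1: "A $$ (v, w) * X w j = 0" using duarte_step.prems(3)[OF jv(2,1)] by simp
    have "(\<Sum>k\<in>S. X j k * A $$ (k, v)) = (\<Sum>k\<in>{w}. X j k * A $$ (k, v))"
      using nb[OF v vC] XC[OF v j] wS fin by (intro sum.mono_neutral_right) auto
    moreover have "(\<Sum>k\<in>S. A $$ (j, k) * X k v) = 0"
      using nb[OF v j] XC[OF v _ vC] Xvw by (intro sum.neutral) auto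
    ultimately have 2: "X j w * A $$ (w, v) = 0" using duarte_step.prems(3)[OF jv] by simp
    show ?thesis using 1 2 N(4,5)[OF v] by simp
  qed
  have Xw: "X w j = 0" "X j w = 0" if "j \<in> S" for j
    using Xw' cover[of j] that diag[OF wn] by (cases "j = w"; auto)+
  \<comment> \<open>With row and column \<open>w\<close> of \<open>X\<close> gone, the index
    \<open>w\<close> drops out and \<open>X\<close> commutes with the submatrix on
    \<open>S - {w}\<close>.\<close>
  have comm: "(\<Sum>k\<in>S - {w}. A $$ (i, k) * X k j) = (\<Sum>k\<in>S - {w}. X i k * A $$ (k, j))"
    if "i \<in> S - {w}" "j \<in> S - {w}" for i j
  proof -
    have "(\<Sum>k\<in>S - {w}. A $$ (i, k) * X k j) = (\<Sum>k\<in>S. A $$ (i, k) * X k j)"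
      using that Xw fin by (intro sum.mono_neutral_left) auto
    also have "\<dots> = (\<Sum>k\<in>S. X i k * A $$ (k, j))" by (rule duarte_step.prems(3)[OF that])
    also have "\<dots> = (\<Sum>k\<in>S - {w}. X i k * A $$ (k, j))"
      using that Xw fin by (intro sum.mono_neutral_right) auto
    finally show ?thesis .
  qed
  obtain ms ls where sp: "spectrum_list (submatrix A (S - {w}) (S - {w})) ms"
    "spectrum_list (submatrix A S S) ls" "strictly_interlaces ms ls"
    using duarte_step.hyps(3) by (auto simp: eigenvalues_strictly_interlace_def)
  hence dist: "distinct ms" by (intro strictly_interlacesD(1)) (auto simp: spectrum_list_def)
  have "X i j = 0" if ij: "i \<in> S - {w}" "j \<in> S - {w}" for i j
  proof -
    obtain v where v: "N v" "i \<in> C v" using cover ij by blast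
    show ?thesis
    proof (cases "j \<in> C v")
      case False
      show ?thesis
      \<comment> \<open>Inside \<open>S - {w}\<close> no edge leaves \<open>C v\<close>, so the
        block between this branch and all the others is covered.\<close>
      proof (rule commuting_off_diagonal_block_zero[OF A _ sp(1) dist _ comm v(2)])
        show "A $$ (x, k) = 0 \<and> A $$ (k, x) = 0" if "x \<in> C v" "k \<in> S - {w} - C v" for x k
          using nb[OF v(1) that(1), of k] that(2) by auto
      qed (use S ij False in auto)
    qed (use XC v in auto)
  qed
  thus ?case using Xw by blast
qed

subsection \<open>Derivatives of traces of powers\<close>

lemma pow_mat_mult_self_comm:
  assumes "(A :: 'a :: semiring_1 mat) \<in> carrier_mat n n"
  shows "A * A ^\<^sub>m k = A ^\<^sub>m k * A"
proof (induction k)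
  case (Suc k)
  have "A * (A ^\<^sub>m k * A) = (A * A ^\<^sub>m k) * A"
    using assms by (simp add: assoc_mult_mat[of _ n n _ n _ n])
  thus ?case using Suc by simp
qed (use assms in simp)

lemma pow_mat_add_exp:
  assumes A: "(A :: 'a :: semiring_1 mat) \<in> carrier_mat n n"
  shows "A ^\<^sub>m (k + l) = A ^\<^sub>m k * A ^\<^sub>m l"
proof (induction l)
  case (Suc l)
  thus ?case using assms by (simp add: assoc_mult_mat[of _ n n _ n _ n])
qed (use assms in simp)

lemma index_mult_mat_sum:
  assumes "A \<in> carrier_mat n m" "B \<in> carrier_mat m l" "i < n" "j < l"
  shows "(A * B) $$ (i, j) = (\<Sum>k<m. A $$ (i, k) * B $$ (k, j))"
  using assms by (auto simp: scalar_prod_def atLeast0LessThan)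

text \<open>Transposition reverses the product and each factor contributes a sign; odd powers are
  therefore skew-symmetric again.\<close>

lemma pow_mat_skew:
  assumes A: "(A :: real mat) \<in> carrier_mat n n"
    and skew: "\<And>i j. i < n \<Longrightarrow> j < n \<Longrightarrow> A $$ (j, i) = - A $$ (i, j)"
    and "i < n" "j < n"
  shows "(A ^\<^sub>m k) $$ (j, i) = (- 1) ^ k * (A ^\<^sub>m k) $$ (i, j)"
  using assms(3,4)
proof (induction k arbitrary: i j)
  case 0
  thus ?case using A by simp
next
  case (Suc k)
  have "(A ^\<^sub>m Suc k) $$ (j, i) = (\<Sum>l<n. (A ^\<^sub>m k) $$ (j, l) * A $$ (l, i))"
    using Suc.prems A by (simp add: index_mult_mat_sum[of _ n n _ n] del: index_mult_mat(1))
  also have "\<dots> = (\<Sum>l<n. (- 1) ^ Suc k * (A $$ (i, l) * (A ^\<^sub>m k) $$ (l, j)))"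
    using Suc.prems by (intro sum.cong) (auto simp: Suc.IH[of _ j] skew[of i])
  also have "\<dots> = (- 1) ^ Suc k * (A * A ^\<^sub>m k) $$ (i, j)"
    using Suc.prems A
    by (simp add: index_mult_mat_sum[of _ n n _ n] sum_distrib_left del: index_mult_mat(1))
  finally show ?case by (simp only: pow_mat_mult_self_comm[OF A] pow_mat.simps)
qed

lemma trace_mat_comm:
  assumes "A \<in> carrier_mat n m" "B \<in> carrier_mat m n"
  shows "trace_mat (A * B) = trace_mat (B * A)"
proof -
  have "trace_mat (A * B) = (\<Sum>i<n. \<Sum>k<m. A $$ (i, k) * B $$ (k, i))"
    using assms by (simp add: trace_mat_def index_mult_mat_sum[of _ n m _ n] del: index_mult_mat(1))
  also have "\<dots> = (\<Sum>k<m. \<Sum>i<n. B $$ (k, i) * A $$ (i, k))"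
    by (subst sum.swap) (simp add: mult.commute)
  also have "\<dots> = trace_mat (B * A)"
    using assms by (simp add: trace_mat_def index_mult_mat_sum[of _ m n _ m] del: index_mult_mat(1))
  finally show ?thesis .
qed

lemma trace_mat_add:
  assumes "A \<in> carrier_mat n n" "B \<in> carrier_mat n n"
  shows "trace_mat (A + B) = trace_mat A + trace_mat B"
  using assms by (simp add: trace_mat_def sum.distrib)

text \<open>A column of the Jacobian matrix moves one coordinate only, so curves of matrices in one
  real parameter suffice.\<close>

definition has_mat_derivative :: "nat \<Rightarrow> (real \<Rightarrow> real mat) \<Rightarrow> real mat \<Rightarrow> real \<Rightarrow> bool" where
  "has_mat_derivative n F F' t \<longleftrightarrow>
     (\<forall>i<n. \<forall>j<n. ((\<lambda>s. F s $$ (i, j)) has_field_derivative F' $$ (i, j)) (at t))"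

lemma has_mat_derivative_mult:
  assumes "\<And>s. F s \<in> carrier_mat n n" "\<And>s. G s \<in> carrier_mat n n"
    and "F' \<in> carrier_mat n n" "G' \<in> carrier_mat n n"
    and "has_mat_derivative n F F' t" "has_mat_derivative n G G' t"
  shows "has_mat_derivative n (\<lambda>s. F s * G s) (F' * G t + F t * G') t"
  unfolding has_mat_derivative_def
proof (intro allI impI)
  fix i j assume ij: "i < n" "j < n"
  have "((\<lambda>s. \<Sum>k<n. F s $$ (i, k) * G s $$ (k, j)) has_field_derivative
      (\<Sum>k<n. F' $$ (i, k) * G t $$ (k, j) + F t $$ (i, k) * G' $$ (k, j))) (at t)"
  proof (rule DERIV_sum)
    fix k assume "k \<in> {..<n}"
    hence "((\<lambda>s. F s $$ (i, k)) has_field_derivative F' $$ (i, k)) (at t)"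
      "((\<lambda>s. G s $$ (k, j)) has_field_derivative G' $$ (k, j)) (at t)"
      using assms(5,6) ij by (auto simp: has_mat_derivative_def)
    from DERIV_mult[OF this] show "((\<lambda>s. F s $$ (i, k) * G s $$ (k, j)) has_field_derivative
      F' $$ (i, k) * G t $$ (k, j) + F t $$ (i, k) * G' $$ (k, j)) (at t)"
      by (simp add: algebra_simps)
  qed
  moreover have "(F' * G t + F t * G') $$ (i, j) =
      (\<Sum>k<n. F' $$ (i, k) * G t $$ (k, j) + F t $$ (i, k) * G' $$ (k, j))"
    using ij carrier_matD[OF assms(3)] carrier_matD[OF assms(4)] assms(1,2)[of t]
    by (simp add: index_mult_mat_sum[OF assms(3,2)] index_mult_mat_sum[OF assms(1,4)] sum.distrib
        del: index_mult_mat(1))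
  moreover have "(\<lambda>s. (F s * G s) $$ (i, j)) = (\<lambda>s. \<Sum>k<n. F s $$ (i, k) * G s $$ (k, j))"
    using assms(1,2) ij by (intro ext index_mult_mat_sum) auto
  ultimately show "((\<lambda>s. (F s * G s) $$ (i, j)) has_field_derivative
      (F' * G t + F t * G') $$ (i, j)) (at t)" by simp
qed

text \<open>The product rule produces terms with \<open>F'\<close> between two powers of
  \<open>F t\<close>; cyclicity of the trace makes them all equal.\<close>

lemma has_field_derivative_trace_pow:
  assumes F: "\<And>s. F s \<in> carrier_mat n n" and F': "F' \<in> carrier_mat n n"
    and d: "has_mat_derivative n F F' t"
  shows "((\<lambda>s. trace_mat (F s ^\<^sub>m k)) has_field_derivative
    real k * trace_mat (F t ^\<^sub>m (k - 1) * F')) (at t)"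
proof -
  let ?P = "F t"
  have as: "(X * V) * W = X * (V * W)" if "X \<in> carrier_mat n n" "V \<in> carrier_mat n n" "W \<in> carrier_mat n n"
    for X V W :: "real mat" using that by (rule assoc_mult_mat)
  have pc: "F s ^\<^sub>m l \<in> carrier_mat n n" for s l using F by (rule pow_carrier_mat)
  note c = F F' pc mult_carrier_mat[of _ n n _ n]
  \<comment> \<open>The trailing power with arbitrary \<open>l\<close> strengthens the induction,
    because the product rule multiplies the old derivative \<open>D\<close> by \<open>F t\<close>;
    \<open>l = 0\<close> is used in the end.\<close>
  have "\<exists>D\<in>carrier_mat n n. has_mat_derivative n (\<lambda>s. F s ^\<^sub>m k) D t \<and>
      (\<forall>l. trace_mat (D * ?P ^\<^sub>m l) = real k * trace_mat (?P ^\<^sub>m (k - 1 + l) * F'))"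
  proof (induction k)
    case 0
    have "has_mat_derivative n (\<lambda>s. F s ^\<^sub>m 0) (0\<^sub>m n n) t"
      using F by (auto simp: has_mat_derivative_def carrier_matD(1)[OF F])
    moreover have "trace_mat (0\<^sub>m n n * ?P ^\<^sub>m l) = 0" for l
      using left_mult_zero_mat[OF pc[of t l], of n] by (simp add: trace_mat_def)
    ultimately show ?case by (intro bexI[of _ "0\<^sub>m n n"]) auto
  next
    case (Suc k)
    then obtain D where D: "D \<in> carrier_mat n n" "has_mat_derivative n (\<lambda>s. F s ^\<^sub>m k) D t"
      and tr: "\<And>l. trace_mat (D * ?P ^\<^sub>m l) = real k * trace_mat (?P ^\<^sub>m (k - 1 + l) * F')"
      by blast
    let ?D = "D * ?P + ?P ^\<^sub>m k * F'"
    have "has_mat_derivative n (\<lambda>s. F s ^\<^sub>m Suc k) ?D t"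
      using has_mat_derivative_mult[OF pc F D(1) F' D(2) d] by simp
    moreover have "trace_mat (?D * ?P ^\<^sub>m l) = real (Suc k) * trace_mat (?P ^\<^sub>m (k + l) * F')" for l
    proof -
      have "?D * ?P ^\<^sub>m l = D * ?P ^\<^sub>m Suc l + ?P ^\<^sub>m k * F' * ?P ^\<^sub>m l"
        using add_mult_distrib_mat[of "D * ?P" n n "?P ^\<^sub>m k * F'" "?P ^\<^sub>m l" n] D(1)
        by (simp add: c as pow_mat_mult_self_comm[OF F])
      hence "trace_mat (?D * ?P ^\<^sub>m l) = trace_mat (D * ?P ^\<^sub>m Suc l) + trace_mat (?P ^\<^sub>m k * F' * ?P ^\<^sub>m l)"
        by (simp add: trace_mat_add[of _ n] c D(1) del: pow_mat.simps)
      also have "trace_mat (?P ^\<^sub>m k * F' * ?P ^\<^sub>m l) = trace_mat (?P ^\<^sub>m l * (?P ^\<^sub>m k * F'))"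
        by (intro trace_mat_comm[of _ n n]) (simp_all add: c)
      also have "?P ^\<^sub>m l * (?P ^\<^sub>m k * F') = ?P ^\<^sub>m (k + l) * F'"
        using pow_mat_add_exp[OF F, of t l k] by (simp add: c add.commute flip: as)
      \<comment> \<open>The exponents \<open>k - 1 + Suc l\<close> and \<open>k + l\<close> differ
        at \<open>k = 0\<close>, where the factor \<open>real k\<close> vanishes.\<close>
      also have "trace_mat (D * ?P ^\<^sub>m Suc l) = real k * trace_mat (?P ^\<^sub>m (k + l) * F')"
        by (subst tr) (cases k; simp)
      finally show ?thesis by (simp add: algebra_simps)
    qed
    moreover have "?D \<in> carrier_mat n n" by (simp add: c D(1))
    ultimately show ?case by (intro bexI[of _ ?D]) auto
  qed
  then obtain D where D: "D \<in> carrier_mat n n" "has_mat_derivative n (\<lambda>s. F s ^\<^sub>m k) D t"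
    and tr: "trace_mat (D * ?P ^\<^sub>m 0) = real k * trace_mat (?P ^\<^sub>m (k - 1 + 0) * F')"
    by blast
  have "((\<lambda>s. \<Sum>i<n. (F s ^\<^sub>m k) $$ (i, i)) has_field_derivative (\<Sum>i<n. D $$ (i, i))) (at t)"
    using D(2) by (intro DERIV_sum) (auto simp: has_mat_derivative_def)
  moreover have "(\<Sum>i<n. D $$ (i, i)) = real k * trace_mat (?P ^\<^sub>m (k - 1) * F')"
    using tr D(1) F[of t] by (simp add: trace_mat_def carrier_matD)
  moreover have "trace_mat (F s ^\<^sub>m k) = (\<Sum>i<n. (F s ^\<^sub>m k) $$ (i, i))" for s
    using F[of s] by (simp add: trace_mat_def)
  ultimately show ?thesis by simp
qed

subsection \<open>The Jacobian matrix\<close>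

text \<open>The leading principal block: sizes \<open>n\<close> and \<open>n - 1\<close> give
  \<open>M\<close> and \<open>N\<close>, so both families of traces are treated at once.\<close>

definition corner :: "nat \<Rightarrow> 'a mat \<Rightarrow> 'a mat" where
  "corner m B = mat m m (\<lambda>ij. B $$ ij)"

lemma corner_carrier [simp]: "corner m B \<in> carrier_mat m m"
  by (simp add: corner_def)

lemma index_corner [simp]: "i < m \<Longrightarrow> j < m \<Longrightarrow> corner m B $$ (i, j) = B $$ (i, j)"
  by (simp add: corner_def)

lemma corner_self: "B \<in> carrier_mat m m \<Longrightarrow> corner m B = B"
  by (intro eq_matI) (auto simp: corner_def)

text \<open>On an initial segment \<open>pick\<close> is the identity, which links the label-based
  submatrices of the Duarte property to leading blocks.\<close>

lemma submatrix_lessThan: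
  assumes "A \<in> carrier_mat n n" "m \<le> n"
  shows "submatrix A {..<m} {..<m} = corner m A"
proof -
  have "pick {..<m} i = i" if "i < m" for i
  proof -
    have "{a \<in> {..<m}. a < i} = {..<i}" using that by auto
    thus ?thesis using pick_card_in_set[of i "{..<m}"] that by simp
  qed
  moreover have "{i. i < n \<and> i \<in> {..<m}} = {..<m}" using assms(2) by auto
  ultimately show ?thesis using assms(1)
    by (intro eq_matI) (auto simp: submatrix_def corner_def)
qed

lemma N_mat_eq_corner: "N_mat n e x = corner (n - 1) (M_mat n e x)"
  by (intro eq_matI) (auto simp: N_mat_def corner_def mat_delete_def M_mat_def)

lemma M_mat_carrier [simp]: "M_mat n e x \<in> carrier_mat n n"
  by (simp add: M_mat_def)

lemma M_mat_skew:
  assumes "\<And>k. k < n - 1 \<Longrightarrow> fst (e k) < snd (e k)" "i < n" "j < n"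
  shows "M_mat n e x $$ (j, i) = - M_mat n e x $$ (i, j)"
proof -
  have "(j, i) \<noteq> e k" if "(i, j) = e k" "k < n - 1" for k
    using assms(1)[OF that(2)] that(1) by (metis fst_conv less_asym snd_conv)
  thus ?thesis using assms(2,3)
    by (auto simp: M_mat_def simp flip: sum_negf intro!: sum.cong)
qed

text \<open>The partial derivative of the leading block of \<open>M\<close> in the coordinate of the
  edge \<open>ij\<close>; it is zero if the edge leaves the block.\<close>

definition edge_mat :: "nat \<Rightarrow> nat \<times> nat \<Rightarrow> real mat" where
  "edge_mat m ij = mat m m (\<lambda>(a, b). if (a, b) = ij then 1 else if (b, a) = ij then - 1 else 0)"

lemma has_mat_derivative_M_mat:
  assumes "c < n - 1" "dim_vec x = n - 1" "m \<le> n"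
  shows "has_mat_derivative m (\<lambda>s. corner m (M_mat n e (update_vec x c s))) (edge_mat m (e c)) t"
  unfolding has_mat_derivative_def
proof (intro allI impI)
  fix i j assume ij: "i < m" "j < m"
  have "((\<lambda>s. \<Sum>k<n - 1. if (i, j) = e k then update_vec x c s $ k
          else if (j, i) = e k then - (update_vec x c s $ k) else 0) has_field_derivative
        (\<Sum>k<n - 1. if k = c then edge_mat m (e c) $$ (i, j) else 0)) (at t)"
  proof (rule DERIV_sum)
    fix k assume k: "k \<in> {..<n - 1}"
    show "((\<lambda>s. if (i, j) = e k then update_vec x c s $ k
          else if (j, i) = e k then - (update_vec x c s $ k) else 0) has_field_derivative
        (if k = c then edge_mat m (e c) $$ (i, j) else 0)) (at t)"
    proof (cases "k = c")
      case True
      thus ?thesis using assms ij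
        by (auto simp: edge_mat_def intro!: derivative_eq_intros)
    next
      case False
      hence "\<And>s. update_vec x c s $ k = x $ k" by simp
      thus ?thesis using False by (simp only: if_False DERIV_const)
    qed
  qed
  moreover have "corner m (M_mat n e (update_vec x c s)) $$ (i, j) =
      (\<Sum>k<n - 1. if (i, j) = e k then update_vec x c s $ k
          else if (j, i) = e k then - (update_vec x c s $ k) else 0)" for s
    using ij assms(3) by (simp add: M_mat_def)
  ultimately show "((\<lambda>s. corner m (M_mat n e (update_vec x c s)) $$ (i, j)) has_field_derivative
      edge_mat m (e c) $$ (i, j)) (at t)"
    using assms(1) by simp
qed

lemma edge_mat_carrier [simp]: "edge_mat m ij \<in> carrier_mat m m"
  by (simp add: edge_mat_def)

text \<open>The entries \<open>1\<close> and \<open>- 1\<close> of the edge matrix select two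
  entries of \<open>P\<close>. As \<open>p < q\<close>, testing \<open>q < m\<close> decides whether
  the edge lies in the block.\<close>

lemma trace_mult_edge_mat:
  assumes P: "P \<in> carrier_mat m m" and "p < q"
  shows "trace_mat (P * edge_mat m (p, q)) = (if q < m then P $$ (q, p) - P $$ (p, q) else 0)"
proof -
  have delta: "(\<Sum>a<m. \<Sum>k<m. if a = i \<and> k = j then P $$ (a, k) else 0)
      = (if i < m \<and> j < m then P $$ (i, j) else 0)" for i j
  proof -
    have "(\<Sum>a<m. \<Sum>k<m. if a = i \<and> k = j then P $$ (a, k) else 0)
        = (\<Sum>a<m. if a = i then \<Sum>k<m. if k = j then P $$ (i, k) else 0 else 0)"
      by (intro sum.cong refl) auto
    thus ?thesis by simp
  qed
  have dim: "dim_row (P * edge_mat m (p, q)) = m" using P by simp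
  have "trace_mat (P * edge_mat m (p, q)) = (\<Sum>a<m. \<Sum>k<m. P $$ (a, k) * edge_mat m (p, q) $$ (k, a))"
    unfolding trace_mat_def dim
    by (intro sum.cong refl index_mult_mat_sum[OF P edge_mat_carrier]) auto
  also have "\<dots> = (\<Sum>a<m. \<Sum>k<m. (if a = q \<and> k = p then P $$ (a, k) else 0)
      - (if a = p \<and> k = q then P $$ (a, k) else 0))"
    using \<open>p < q\<close> by (intro sum.cong refl) (auto simp: edge_mat_def)
  also have "\<dots> = (if q < m then P $$ (q, p) - P $$ (p, q) else 0)"
    using \<open>p < q\<close> unfolding sum_subtractf delta by auto
  finally show ?thesis .
qed

text \<open>The factor \<open>2 * Suc r\<close> of the power rule and a factor \<open>2\<close> from
  skew-symmetry of the odd power cancel the denominator \<open>4 * real (Suc r)\<close>.\<close>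

lemma deriv_trace_corner_M_mat:
  assumes e: "\<And>k. k < n - 1 \<Longrightarrow> fst (e k) < snd (e k)"
    and c: "c < n - 1" and x: "dim_vec x = n - 1" and m: "m \<le> n"
  shows "deriv (\<lambda>t. trace_mat (corner m (M_mat n e (update_vec x c t)) ^\<^sub>m (2 * Suc r)) / (4 * real (Suc r))) (x $ c)
    = - (if snd (e c) < m then (corner m (M_mat n e x) ^\<^sub>m (2 * r + 1)) $$ e c else 0)"
proof -
  let ?B = "corner m (M_mat n e x)"
  obtain p q where pq: "e c = (p, q)" by (cases "e c")
  have "p < q" using e[OF c] pq by simp
  have upd: "update_vec x c (x $ c) = x" by (intro eq_vecI) (auto simp: update_vec_def)
  have "?B $$ (j, i) = - ?B $$ (i, j)" if "i < m" "j < m" for i j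
    using that m M_mat_skew[OF e, where i = i and j = j and x = x] by simp
  from pow_mat_skew[OF corner_carrier this, of p q "2 * r + 1"]
  have sk: "(?B ^\<^sub>m (2 * r + 1)) $$ (q, p) = - (?B ^\<^sub>m (2 * r + 1)) $$ (p, q)" if "q < m"
    using that \<open>p < q\<close> by simp
  define Q where "Q = ?B ^\<^sub>m (2 * r + 1)"
  have Q: "Q \<in> carrier_mat m m" unfolding Q_def by (intro pow_carrier_mat corner_carrier)
  have "((\<lambda>t. trace_mat (corner m (M_mat n e (update_vec x c t)) ^\<^sub>m (2 * Suc r))) has_field_derivative
    real (2 * Suc r) * trace_mat (?B ^\<^sub>m (2 * Suc r - 1) * edge_mat m (e c))) (at (x $ c))"
    using has_field_derivative_trace_pow[OF corner_carrier edge_mat_carrier has_mat_derivative_M_mat[OF c x m],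
        where e1 = e and t = "x $ c" and k = "2 * Suc r"]
    unfolding upd .
  moreover have "2 * Suc r - 1 = 2 * r + 1" by simp
  ultimately have "((\<lambda>t. trace_mat (corner m (M_mat n e (update_vec x c t)) ^\<^sub>m (2 * Suc r))) has_field_derivative
    real (2 * Suc r) * trace_mat (Q * edge_mat m (p, q))) (at (x $ c))"
    unfolding pq by (simp only: Q_def)
  from DERIV_cdivide[OF this, of "4 * real (Suc r)"]
  have "deriv (\<lambda>t. trace_mat (corner m (M_mat n e (update_vec x c t)) ^\<^sub>m (2 * Suc r)) / (4 * real (Suc r))) (x $ c)
    = real (2 * Suc r) * (if q < m then Q $$ (q, p) - Q $$ (p, q) else 0) / (4 * real (Suc r))"
    unfolding trace_mult_edge_mat[OF Q \<open>p < q\<close>] by (rule DERIV_imp_deriv)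
  also have "\<dots> = - (if q < m then Q $$ (p, q) else 0)"
    using sk[folded Q_def] by (auto simp: field_simps)
  finally show ?thesis by (simp only: pq snd_conv Q_def)
qed

section \<open>Coordinates of \<open>f_map\<close> and entries of its Jacobian matrix\<close>

lemma index_f_map:
  assumes "r < n - 1"
  shows "f_map n e x $ r = (if r < n div 2
    then trace_mat (corner n (M_mat n e x) ^\<^sub>m (2 * Suc r)) / (4 * real (Suc r))
    else trace_mat (corner (n - 1) (M_mat n e x) ^\<^sub>m (2 * Suc (r - n div 2))) / (4 * real (Suc (r - n div 2))))"
proof -
  \<comment> \<open>For either parity of \<open>n\<close> the two families of traces fill exactly
    \<open>n - 1\<close> coordinates.\<close>
  have "n - 1 = n div 2 + (n - 1) div 2" by presburger
  hence "r - n div 2 < (n - 1) div 2" if "\<not> r < n div 2" using assms that by linarith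
  thus ?thesis
    by (simp add: f_map_def vec_of_list_index nth_append N_mat_eq_corner corner_self
        del: pow_mat.simps upt_Suc)
qed

lemma dim_f_map: "dim_vec (f_map n e x) = n - 1"
  unfolding f_map_def by (simp del: upt_Suc; presburger)

lemma index_jacobian_f_map:
  assumes e: "\<And>k. k < n - 1 \<Longrightarrow> fst (e k) < snd (e k)"
    and rc: "r < n - 1" "c < n - 1" and x: "dim_vec x = n - 1" and en: "snd (e c) < n"
  shows "jacobian_mat (f_map n e) x $$ (r, c) = - (if r < n div 2
    then (M_mat n e x ^\<^sub>m (2 * r + 1)) $$ e c
    else if snd (e c) < n - 1 then (corner (n - 1) (M_mat n e x) ^\<^sub>m (2 * (r - n div 2) + 1)) $$ e c else 0)"
proof -
  have J: "jacobian_mat (f_map n e) x $$ (r, c) = deriv (\<lambda>t. f_map n e (update_vec x c t) $ r) (x $ c)"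
    using rc x by (simp add: jacobian_mat_def dim_f_map)
  show ?thesis
  proof (cases "r < n div 2")
    case True
    show ?thesis
      using deriv_trace_corner_M_mat[OF e rc(2) x order.refl, where r = r] en True
      by (simp only: J index_f_map[OF rc(1)] if_True corner_self[OF M_mat_carrier])
  next
    case False
    show ?thesis
      using deriv_trace_corner_M_mat[OF e rc(2) x diff_le_self, where r = "r - n div 2"] False
      by (simp only: J index_f_map[OF rc(1)] if_False)
  qed
qed

text \<open>The point of evaluation recovers \<open>A\<close>: injectivity of the enumeration leaves
  a single summand at each edge, skew-symmetry accounts for the reversed orientation, and entries
  off the edges are zero.\<close>

lemma M_mat_edge_enumeration:
  assumes A: "A \<in> carrier_mat n n" and skew: "\<And>i j. i < n \<Longrightarrow> j < n \<Longrightarrow> A $$ (j, i) = - A $$ (i, j)"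
    and en: "edge_enumeration n (graph_of A) e"
  shows "M_mat n e (vec (n - 1) (\<lambda>k. A $$ e k)) = A"
proof (rule eq_matI)
  fix i j assume "i < dim_row A" "j < dim_col A"
  hence ij: "i < n" "j < n" using A by auto
  let ?s = "\<lambda>k. {fst (e k), snd (e k)}"
  define t where "t k = (if (i, j) = e k then A $$ e k else if (j, i) = e k then - A $$ e k else 0)" for k
  have bij: "bij_betw ?s {..<n - 1} (edges (graph_of A))"
    using en unfolding edge_enumeration_def by (rule conjunct1)
  note inj = bij_betw_imp_inj_on[OF bij] and im = bij_betw_imp_surj_on[OF bij]
  have M: "M_mat n e (vec (n - 1) (\<lambda>k. A $$ e k)) $$ (i, j) = (\<Sum>k<n - 1. t k)"
    unfolding M_mat_def index_mat(1)[OF ij] prod.case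
    by (intro sum.cong refl) (simp add: t_def)
  have s: "?s k = {i, j}" if "(i, j) = e k \<or> (j, i) = e k" for k
  proof -
    have "e k = (i, j) \<or> e k = (j, i)" using that by metis
    thus ?thesis by (elim disjE) (simp_all add: insert_commute)
  qed
  show "M_mat n e (vec (n - 1) (\<lambda>k. A $$ e k)) $$ (i, j) = A $$ (i, j)"
  proof (cases "{i, j} \<in> edges (graph_of A)")
    case True
    hence "{i, j} \<in> ?s ` {..<n - 1}" unfolding im .
    then obtain k where "k \<in> {..<n - 1}" and sk: "{i, j} = ?s k" by (rule imageE)
    hence k: "k < n - 1" by simp
    have "t l = 0" if l: "l < n - 1" "l \<noteq> k" for l
    proof -
      have "\<not> ((i, j) = e l \<or> (j, i) = e l)"
      proof
        assume "(i, j) = e l \<or> (j, i) = e l"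
        from s[OF this] have "?s l = ?s k" unfolding sk .
        from inj_onD[OF inj this] show False using l k by simp
      qed
      thus ?thesis by (simp add: t_def)
    qed
    hence "(\<Sum>k<n - 1. t k) = (\<Sum>k\<in>{k}. t k)"
      using k by (intro sum.mono_neutral_right) auto
    also have "\<dots> = A $$ (i, j)"
    proof -
      have "e k = (i, j) \<or> e k = (j, i)"
        using sk by (cases "e k") (auto simp: doubleton_eq_iff)
      thus ?thesis
      proof
        assume "e k = (j, i)"
        thus ?thesis by (cases "i = j") (simp_all add: t_def skew[OF ij])
      qed (simp add: t_def)
    qed
    finally show ?thesis unfolding M .
  next
    case False
    have "t k = 0" if k: "k < n - 1" for k
    proof -
      have "\<not> ((i, j) = e k \<or> (j, i) = e k)"
      proof
        assume "(i, j) = e k \<or> (j, i) = e k"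
        from s[OF this] have "{i, j} \<in> ?s ` {..<n - 1}" using k by (intro image_eqI[of _ _ k]) simp_all
        thus False using False im by simp
      qed
      thus ?thesis by (simp add: t_def)
    qed
    hence "(\<Sum>k<n - 1. t k) = 0" by simp
    moreover have "A $$ (i, j) = 0" using False edge_graph_of_iff[OF A skew ij] by blast
    ultimately show ?thesis by (simp only: M)
  qed
qed (use A in \<open>auto simp: M_mat_def\<close>)

section \<open>Polynomials in a matrix: commutation and left eigenvectors\<close>

lemma commutator_power_sum:
  assumes B: "(B :: real mat) \<in> carrier_mat m m" and ij: "i < m" "j < m"
  shows "(\<Sum>k<m. B $$ (i, k) * (\<Sum>r\<in>R. a r * (B ^\<^sub>m p r) $$ (k, j)))
    = (\<Sum>k<m. (\<Sum>r\<in>R. a r * (B ^\<^sub>m p r) $$ (i, k)) * B $$ (k, j))"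
proof -
  have "(\<Sum>k<m. B $$ (i, k) * (\<Sum>r\<in>R. a r * (B ^\<^sub>m p r) $$ (k, j)))
      = (\<Sum>r\<in>R. a r * (\<Sum>k<m. B $$ (i, k) * (B ^\<^sub>m p r) $$ (k, j)))"
    by (simp add: sum_distrib_left mult.left_commute) (rule sum.swap)
  also have "\<dots> = (\<Sum>r\<in>R. a r * (B * B ^\<^sub>m p r) $$ (i, j))"
    using B ij by (simp add: index_mult_mat_sum[of _ m m _ m] del: index_mult_mat(1))
  also have "\<dots> = (\<Sum>r\<in>R. a r * (\<Sum>k<m. (B ^\<^sub>m p r) $$ (i, k) * B $$ (k, j)))"
    using B ij by (simp add: pow_mat_mult_self_comm[OF B] index_mult_mat_sum[of _ m m _ m] del: index_mult_mat(1))
  also have "\<dots> = (\<Sum>k<m. (\<Sum>r\<in>R. a r * (B ^\<^sub>m p r) $$ (i, k)) * B $$ (k, j))"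
    by (simp add: sum_distrib_left sum_distrib_right mult.assoc) (rule sum.swap)
  finally show ?thesis .
qed

text \<open>A matrix and its transpose share the characteristic polynomial. Writing eigenvectors as
  functions lets the same \<open>u\<close> serve a matrix and its leading block.\<close>

lemma eigenvalue_iff_left:
  assumes B: "B \<in> carrier_mat m m"
  shows "eigenvalue (map_mat complex_of_real B) z \<longleftrightarrow>
    (\<exists>u. (\<exists>i<m. u i \<noteq> 0) \<and> (\<forall>j<m. (\<Sum>i<m. u i * complex_of_real (B $$ (i, j))) = z * u j))"
proof -
  let ?C = "map_mat complex_of_real B"
  have C: "?C \<in> carrier_mat m m" "transpose_mat ?C \<in> carrier_mat m m" using B by auto
  have e: "(transpose_mat ?C *\<^sub>v v = z \<cdot>\<^sub>v v) \<longleftrightarrow> (\<forall>j<m. (\<Sum>i<m. v $ i * complex_of_real (B $$ (i, j))) = z * v $ j)"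
    if "v \<in> carrier_vec m" for v
  proof -
    have "(transpose_mat ?C *\<^sub>v v) $ j = (\<Sum>i<m. v $ i * complex_of_real (B $$ (i, j)))" if "j < m" for j
      using that B \<open>v \<in> carrier_vec m\<close> by (simp add: scalar_prod_def atLeast0LessThan mult.commute)
    moreover have "(transpose_mat ?C *\<^sub>v v = z \<cdot>\<^sub>v v) \<longleftrightarrow>
        (\<forall>j<m. (transpose_mat ?C *\<^sub>v v) $ j = (z \<cdot>\<^sub>v v) $ j)"
      using B that by (auto simp: Matrix.vec_eq_iff simp del: index_mult_mat_vec)
    ultimately show ?thesis using that by simp
  qed
  have "eigenvalue ?C z \<longleftrightarrow> eigenvalue (transpose_mat ?C) z"
    using C by (simp add: eigenvalue_root_char_poly[OF C(1)] eigenvalue_root_char_poly[OF C(2)] char_poly_transpose_mat[OF C(1)])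
  also have "\<dots> \<longleftrightarrow> (\<exists>v\<in>carrier_vec m. v \<noteq> 0\<^sub>v m \<and>
      (\<forall>j<m. (\<Sum>i<m. v $ i * complex_of_real (B $$ (i, j))) = z * v $ j))"
    using B e by (auto simp: eigenvalue_def eigenvector_def)
  also have "\<dots> \<longleftrightarrow> (\<exists>u. (\<exists>i<m. u i \<noteq> 0) \<and> (\<forall>j<m. (\<Sum>i<m. u i * complex_of_real (B $$ (i, j))) = z * u j))"
    (is "?l \<longleftrightarrow> ?r")
  proof
    assume ?l
    then obtain v where "v \<in> carrier_vec m" "v \<noteq> 0\<^sub>v m"
      "\<forall>j<m. (\<Sum>i<m. v $ i * complex_of_real (B $$ (i, j))) = z * v $ j" by blast
    moreover from this obtain i where "i < m" "v $ i \<noteq> 0"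
      by (metis carrier_vecD eq_vecI index_zero_vec)
    ultimately show ?r by blast
  next
    assume ?r
    then obtain u i where u: "i < m" "u i \<noteq> 0" "\<forall>j<m. (\<Sum>i<m. u i * complex_of_real (B $$ (i, j))) = z * u j"
      by blast
    hence "vec m u \<noteq> 0\<^sub>v m" by (metis index_vec index_zero_vec(1))
    thus ?l using u by (intro bexI[of _ "vec m u"]) auto
  qed
  finally show ?thesis .
qed

lemma left_eigenvector_pow:
  assumes B: "B \<in> carrier_mat m m"
    and u: "\<And>j. j < m \<Longrightarrow> (\<Sum>i<m. u i * complex_of_real (B $$ (i, j))) = z * u j" and j: "j < m"
  shows "(\<Sum>i<m. u i * complex_of_real ((B ^\<^sub>m k) $$ (i, j))) = z ^ k * u j"
  using j
proof (induction k arbitrary: j)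
  case 0
  have "(\<Sum>i<m. u i * complex_of_real ((B ^\<^sub>m 0) $$ (i, j))) = (\<Sum>i<m. if i = j then u i else 0)"
    using 0 B by (intro sum.cong) auto
  thus ?case using 0 by simp
next
  case (Suc k)
  have "(\<Sum>i<m. u i * complex_of_real ((B ^\<^sub>m Suc k) $$ (i, j)))
      = (\<Sum>i<m. \<Sum>l<m. u i * complex_of_real ((B ^\<^sub>m k) $$ (i, l)) * complex_of_real (B $$ (l, j)))"
    using Suc.prems B
    by (simp add: index_mult_mat_sum[of _ m m _ m] sum_distrib_left mult.assoc del: index_mult_mat(1))
  also have "\<dots> = (\<Sum>l<m. (\<Sum>i<m. u i * complex_of_real ((B ^\<^sub>m k) $$ (i, l))) * complex_of_real (B $$ (l, j)))"
    by (subst sum.swap) (simp add: sum_distrib_right)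
  also have "\<dots> = z ^ k * (\<Sum>l<m. u l * complex_of_real (B $$ (l, j)))"
    by (simp add: Suc.IH sum_distrib_left mult.assoc)
  also have "\<dots> = z ^ Suc k * u j" using u[OF Suc.prems] by simp
  finally show ?case .
qed

text \<open>Pairing a left eigenvector with column \<open>j\<close> of the polynomial in
  \<open>B\<close> gives its value at \<open>z\<close> times \<open>u j\<close>, so a single zero
  column is enough when \<open>u j \<noteq> 0\<close>.\<close>

lemma odd_power_sum_eigenvalue_root:
  assumes B: "B \<in> carrier_mat m m"
    and u: "\<And>j. j < m \<Longrightarrow> (\<Sum>i<m. u i * complex_of_real (B $$ (i, j))) = z * u j"
    and j: "j < m" "u j \<noteq> 0"
    and zero: "\<And>i. i < m \<Longrightarrow> (\<Sum>r<k. a r * (B ^\<^sub>m (2 * r + 1)) $$ (i, j)) = 0"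
  shows "(\<Sum>r<k. complex_of_real (a r) * z ^ (2 * r + 1)) = 0"
proof -
  have "0 = (\<Sum>i<m. u i * complex_of_real (\<Sum>r<k. a r * (B ^\<^sub>m (2 * r + 1)) $$ (i, j)))"
    using zero by simp
  also have "\<dots> = (\<Sum>r<k. complex_of_real (a r) * (\<Sum>i<m. u i * complex_of_real ((B ^\<^sub>m (2 * r + 1)) $$ (i, j))))"
    by (simp add: sum_distrib_left mult.left_commute del: pow_mat.simps) (rule sum.swap)
  also have "\<dots> = (\<Sum>r<k. complex_of_real (a r) * z ^ (2 * r + 1)) * u j"
    by (simp only: left_eigenvector_pow[OF B u j(1)] sum_distrib_right mult.assoc)
  finally show ?thesis using j(2) by simp
qed

subsection \<open>Linear independence of the rows\<close>

lemma sum_lessThan_add: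
  "sum f {..<h + g} = sum f {..<h} + (\<Sum>s<g. f (h + s))" for f :: "nat \<Rightarrow> 'a :: comm_monoid_add"
  by (induction g) (simp_all add: add.assoc)

lemma det_nonzero_invertible_mat:
  assumes "(J :: 'a :: field mat) \<in> carrier_mat n n" "det J \<noteq> 0"
  shows "invertible_mat J"
proof -
  from det_non_zero_imp_unit[OF assms, of "()"]
  obtain B where "B \<in> carrier_mat n n" "J * B = 1\<^sub>m n" "B * J = 1\<^sub>m n"
    unfolding Units_def ring_mat_def by auto
  thus ?thesis using assms(1)
    by (auto simp: invertible_mat_def inverts_mat_def square_mat.simps)
qed

text \<open>The bounds on \<open>h\<close> and \<open>g\<close> keep the degrees
  \<open>2 * h - 1\<close> and \<open>2 * g - 1\<close> below the numbers \<open>n\<close> and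
  \<open>n - 1\<close> of distinct eigenvalues. The last column determines \<open>a\<close>; the
  leading block is then left with the terms in \<open>b\<close>.\<close>

lemma strictly_interlacing_odd_power_sums_independent:
  assumes A: "A \<in> carrier_mat n n" and n: "1 \<le> n"
    and il: "eigenvalues_strictly_interlace (corner (n - 1) A) A"
    and hg: "2 * h \<le> n" "2 * g \<le> n - 1"
    and col: "\<And>i. i < n \<Longrightarrow> (\<Sum>r<h. a r * (A ^\<^sub>m (2 * r + 1)) $$ (i, n - 1)) = 0"
    and rest: "\<And>i j. i < n - 1 \<Longrightarrow> j < n - 1 \<Longrightarrow> (\<Sum>r<h. a r * (A ^\<^sub>m (2 * r + 1)) $$ (i, j))
      + (\<Sum>s<g. b s * (corner (n - 1) A ^\<^sub>m (2 * s + 1)) $$ (i, j)) = 0"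
  shows "(\<forall>r<h. a r = 0) \<and> (\<forall>s<g. b s = 0)"
proof -
  let ?B = "corner (n - 1) A"
  obtain ms ls where ms: "spectrum_list ?B ms" and ls: "spectrum_list A ls"
    and si: "strictly_interlaces ms ls"
    using il by (auto simp: eigenvalues_strictly_interlace_def)
  have dist: "distinct ms" "distinct ls" "set ms \<inter> set ls = {}"
    using strictly_interlacesD[OF si] ls by (auto simp: spectrum_list_def)
  note mD = spectrum_listD[OF corner_carrier ms] and lD = spectrum_listD[OF A ls]
  have root: "(\<Sum>r<h. complex_of_real (a r) * z ^ (2 * r + 1)) = 0" if z: "z \<in> set ls" for z
  proof -
    obtain u i where u: "i < n" "u i \<noteq> 0"
      "\<And>j. j < n \<Longrightarrow> (\<Sum>i<n. u i * complex_of_real (A $$ (i, j))) = z * u j"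
      using z unfolding lD(2) mem_Collect_eq eigenvalue_iff_left[OF A] by blast
    \<comment> \<open>Otherwise \<open>u\<close>, cut to its first \<open>n - 1\<close> coordinates,
      is a left eigenvector of the block, and \<open>z\<close> is an eigenvalue shared by both
      matrices.\<close>
    have "u (n - 1) \<noteq> 0"
    proof
      assume 0: "u (n - 1) = 0"
      have "(\<Sum>i<n - 1. u i * complex_of_real (?B $$ (i, j))) = z * u j" if j: "j < n - 1" for j
      proof -
        have "(\<Sum>i<n - 1. u i * complex_of_real (?B $$ (i, j))) = (\<Sum>i<n - 1. u i * complex_of_real (A $$ (i, j)))"
          using j by (intro sum.cong) auto
        also have "\<dots> = (\<Sum>i<Suc (n - 1). u i * complex_of_real (A $$ (i, j)))" using 0 by simp
        also have "\<dots> = z * u j" using u(3)[of j] j n by simp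
        finally show ?thesis .
      qed
      moreover have "i < n - 1" using u(1,2) 0 by (cases "i = n - 1") auto
      ultimately have "eigenvalue (map_mat complex_of_real ?B) z"
        unfolding eigenvalue_iff_left[OF corner_carrier] using u(2) by blast
      hence "z \<in> set ms" by (simp add: mD(2))
      thus False using dist(3) z by blast
    qed
    thus ?thesis using odd_power_sum_eigenvalue_root[OF A u(3) _ _ col] n by simp
  qed
  have "card (set ls) = n" using distinct_card[OF dist(2)] lD(1) by simp
  hence a: "a r = 0" if "r < h" for r
    using odd_poly_coeffs_zero[of "set ls" h "\<lambda>r. complex_of_real (a r)" r] root hg(1) that by simp
  have root': "(\<Sum>s<g. complex_of_real (b s) * z ^ (2 * s + 1)) = 0" if z: "z \<in> set ms" for z
  proof -
    obtain u i where u: "i < n - 1" "u i \<noteq> 0"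
      "\<And>j. j < n - 1 \<Longrightarrow> (\<Sum>i<n - 1. u i * complex_of_real (?B $$ (i, j))) = z * u j"
      using z unfolding mD(2) mem_Collect_eq eigenvalue_iff_left[OF corner_carrier] by blast
    \<comment> \<open>The whole polynomial in the block vanishes, so the column may be taken at any
      nonzero coordinate of \<open>u\<close>.\<close>
    have "(\<Sum>s<g. b s * (?B ^\<^sub>m (2 * s + 1)) $$ (k, i)) = 0" if "k < n - 1" for k
      using rest[OF that u(1)] a by (simp del: pow_mat.simps)
    thus ?thesis using odd_power_sum_eigenvalue_root[OF corner_carrier u(3,1,2)] by blast
  qed
  have "card (set ms) = n - 1" using distinct_card[OF dist(1)] mD(1) by simp
  hence "b s = 0" if "s < g" for s
    using odd_poly_coeffs_zero[of "set ms" g "\<lambda>s. complex_of_real (b s)" s] root' hg(2) that by simp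
  thus ?thesis using a by blast
qed

text \<open>\<open>Y\<close> is a polynomial in \<open>A\<close> and commutes with it. The padded
  polynomial \<open>W\<close> does so only away from the last row and column, where the zeros of
  \<open>W\<close> reduce the products to those with \<open>B\<close>.\<close>

lemma corner_commutator_zero:
  fixes a b :: "nat \<Rightarrow> real" and g h :: nat
  assumes A: "A \<in> carrier_mat n n" and ij: "i < n - 1" "j < n - 1"
  defines "B \<equiv> corner (n - 1) A"
  defines "Y \<equiv> \<lambda>i j. \<Sum>r<h. a r * (A ^\<^sub>m (2 * r + 1)) $$ (i, j)"
    and "W \<equiv> \<lambda>i j. if i < n - 1 \<and> j < n - 1 then \<Sum>s<g. b s * (B ^\<^sub>m (2 * s + 1)) $$ (i, j) else 0"
  shows "(\<Sum>k<n. A $$ (i, k) * (Y k j + W k j)) = (\<Sum>k<n. (Y i k + W i k) * A $$ (k, j))"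
proof -
  have "(\<Sum>k<n. A $$ (i, k) * Y k j) = (\<Sum>k<n. Y i k * A $$ (k, j))"
    unfolding Y_def using ij by (intro commutator_power_sum[OF A]) auto
  moreover have "(\<Sum>k<n. A $$ (i, k) * W k j) = (\<Sum>k<n. W i k * A $$ (k, j))"
  proof -
    have "(\<Sum>k<n. A $$ (i, k) * W k j) = (\<Sum>k<n - 1. A $$ (i, k) * W k j)"
      by (intro sum.mono_neutral_right) (auto simp: W_def)
    also have "\<dots> = (\<Sum>k<n - 1. B $$ (i, k) * (\<Sum>s<g. b s * (B ^\<^sub>m (2 * s + 1)) $$ (k, j)))"
      using ij by (intro sum.cong) (auto simp: W_def B_def)
    also have "\<dots> = (\<Sum>k<n - 1. (\<Sum>s<g. b s * (B ^\<^sub>m (2 * s + 1)) $$ (i, k)) * B $$ (k, j))"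
      unfolding B_def by (rule commutator_power_sum[OF corner_carrier ij])
    also have "\<dots> = (\<Sum>k<n - 1. W i k * A $$ (k, j))"
      using ij by (intro sum.cong) (auto simp: W_def B_def)
    also have "\<dots> = (\<Sum>k<n. W i k * A $$ (k, j))"
      by (intro sum.mono_neutral_left) (auto simp: W_def)
    finally show ?thesis .
  qed
  ultimately show ?thesis by (simp add: distrib_left distrib_right sum.distrib)
qed

theorem theorem4p6:
  fixes n :: nat and T :: "nat ugraph" and A :: "real mat" and e :: "nat \<Rightarrow> nat \<times> nat"
  assumes "is_tree T" and "verts T = {..<n}"
    and "edge_enumeration n T e"
    and "neb T (n - 1)"
    and "A \<in> skew_matrices T"
    and "duarte A (n - 1)"
  shows "invertible_mat (jacobian_mat (f_map n e) (vec (n - 1) (\<lambda>k. A $$ e k)))"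
proof -
  have G: "graph_of A = T" and AT: "transpose_mat A = - A" and sq: "square_mat A"
    using assms(5) by (auto simp: skew_matrices_def)
  have "{..<dim_row A} = {..<n}" using assms(2) unfolding G[symmetric] by (simp add: graph_of_def)
  hence A: "A \<in> carrier_mat n n" using sq by (auto simp: square_mat.simps)
  have skew: "A $$ (j, i) = - A $$ (i, j)" if "i < n" "j < n" for i j
  proof -
    have "A $$ (j, i) = transpose_mat A $$ (i, j)" using A that by simp
    also have "\<dots> = - A $$ (i, j)" unfolding AT using A that by simp
    finally show ?thesis .
  qed
  define x where "x = vec (n - 1) (\<lambda>k. A $$ e k)"
  have x: "dim_vec x = n - 1" by (simp add: x_def)
  have M: "M_mat n e x = A"
    unfolding x_def using M_mat_edge_enumeration[OF A skew] assms(3) G by blast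
  have bij: "bij_betw (\<lambda>k. {fst (e k), snd (e k)}) {..<n - 1} (edges T)"
    and e: "\<And>k. k < n - 1 \<Longrightarrow> fst (e k) < snd (e k)"
    using assms(3) by (auto simp: edge_enumeration_def)
  have sub: "\<epsilon> \<subseteq> {..<n}" if "\<epsilon> \<in> edges T" for \<epsilon>
    using assms(1,2) that by (auto simp: is_tree_def simple_graph_def)
  have en: "snd (e k) < n" if "k < n - 1" for k
  proof -
    have "{fst (e k), snd (e k)} \<in> edges T" using bij_betwE[OF bij] that by simp
    from sub[OF this] show ?thesis by simp
  qed
  have n: "1 \<le> n" using assms(1,2) by (cases n) (auto simp: is_tree_def connected_graph_def)
  \<comment> \<open>\<open>h\<close> and \<open>g\<close> count the rows of the Jacobian matrix that
    come from \<open>M\<close> and from \<open>N\<close>.\<close>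
  define h g where "h = n div 2" and "g = (n - 1) div 2"
  have hg: "n - 1 = h + g" "2 * h \<le> n" "2 * g \<le> n - 1"
    unfolding h_def g_def by presburger+
  let ?J = "jacobian_mat (f_map n e) x"
  let ?B = "corner (n - 1) A"
  have J: "?J \<in> carrier_mat (n - 1) (n - 1)"
    by (simp add: jacobian_mat_def dim_f_map x)
  \<comment> \<open>A kernel vector \<open>v\<close> of the transpose is a dependence between the
    rows: its first \<open>h\<close> coordinates are the coefficients of \<open>p\<close>, the
    remaining \<open>g\<close> those of \<open>q\<close>.\<close>
  have "det (transpose_mat ?J) \<noteq> 0"
  proof
    assume "det (transpose_mat ?J) = 0"
    then obtain v where v: "v \<in> carrier_vec (n - 1)" "v \<noteq> 0\<^sub>v (n - 1)"
      "transpose_mat ?J *\<^sub>v v = 0\<^sub>v (n - 1)"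
      using det_0_iff_vec_prod_zero[of "transpose_mat ?J" "n - 1"] J by auto
    define Y where "Y i j = (\<Sum>r<h. v $ r * (A ^\<^sub>m (2 * r + 1)) $$ (i, j))" for i j
    define W where "W i j = (if i < n - 1 \<and> j < n - 1
      then \<Sum>s<g. v $ (h + s) * (?B ^\<^sub>m (2 * s + 1)) $$ (i, j) else 0)" for i j
    \<comment> \<open>Coordinate \<open>c\<close> of the kernel equation is, up to sign, the entry
      of \<open>X\<close> at the edge \<open>e c\<close>.\<close>
    have edge: "Y p q + W p q = 0" if c: "c < n - 1" and pq: "e c = (p, q)" for c p q
    proof -
      have "p < q" using e[OF c] pq by simp
      have Jc: "?J $$ (r, c) = - (if r < h then (A ^\<^sub>m (2 * r + 1)) $$ (p, q)
          else if q < n - 1 then (?B ^\<^sub>m (2 * (r - h) + 1)) $$ (p, q) else 0)" if "r < n - 1" for r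
        using index_jacobian_f_map[where n = n and e = e, OF _ that c x en[OF c]] e
        unfolding M pq snd_conv h_def by blast
      have "0 = (transpose_mat ?J *\<^sub>v v) $ c" using v(3) c by simp
      also have "\<dots> = (\<Sum>r<h + g. ?J $$ (r, c) * v $ r)"
        using v(1) c J hg(1) by (simp add: scalar_prod_def atLeast0LessThan)
      also have "\<dots> = (\<Sum>r<h. ?J $$ (r, c) * v $ r) + (\<Sum>s<g. ?J $$ (h + s, c) * v $ (h + s))"
        by (rule sum_lessThan_add)
      also have "(\<Sum>r<h. ?J $$ (r, c) * v $ r) = - Y p q"
        unfolding Y_def sum_negf[symmetric] using hg(1)
        by (intro sum.cong refl) (simp add: Jc del: pow_mat.simps)
      also have "(\<Sum>s<g. ?J $$ (h + s, c) * v $ (h + s))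
          = (\<Sum>s<g. - (if q < n - 1 then v $ (h + s) * (?B ^\<^sub>m (2 * s + 1)) $$ (p, q) else 0))"
        using hg(1) by (intro sum.cong refl) (simp add: Jc del: pow_mat.simps)
      also have "\<dots> = - W p q"
        using \<open>p < q\<close> by (cases "q < n - 1") (simp_all add: W_def sum_negf del: pow_mat.simps)
      finally show ?thesis by simp
    qed
    have odd: "(C ^\<^sub>m (2 * r + 1)) $$ (j, i) = - (C ^\<^sub>m (2 * r + 1)) $$ (i, j)"
      if "C \<in> carrier_mat m m" "\<And>i j. i < m \<Longrightarrow> j < m \<Longrightarrow> C $$ (j, i) = - C $$ (i, j)" "i < m" "j < m"
      for C :: "real mat" and m r i j
      using pow_mat_skew[OF that, of "2 * r + 1"] by (simp del: pow_mat.simps)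
    have Ysk: "Y j i = - Y i j" if "i < n" "j < n" for i j
      unfolding Y_def using odd[OF A skew that] by (simp add: sum_negf del: pow_mat.simps)
    have Bsk: "?B $$ (j, i) = - ?B $$ (i, j)" if "i < n - 1" "j < n - 1" for i j
      using that skew[of i j] by simp
    have Wsk: "W j i = - W i j" for i j
    proof (cases "i < n - 1 \<and> j < n - 1")
      case True
      hence ij: "i < n - 1" "j < n - 1" by auto
      have "(?B ^\<^sub>m (2 * s + 1)) $$ (j, i) = - (?B ^\<^sub>m (2 * s + 1)) $$ (i, j)" for s
        by (rule odd[OF corner_carrier Bsk ij])
      thus ?thesis unfolding W_def using ij by (simp add: sum_negf del: pow_mat.simps One_nat_def)
    qed (auto simp: W_def)
    have X: "\<forall>i\<in>{..<n}. \<forall>j\<in>{..<n}. Y i j + W i j = 0"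
    proof (rule duarte_on_commutator_zero[OF A skew, where w = "n - 1"])
      show "\<not> (\<exists>vs. is_cycle (graph_of A) vs)" using assms(1) by (simp add: G is_tree_def)
      show "Y i i + W i i = 0" if "i < n" for i using Ysk[OF that that] Wsk[of i i] by simp
      show "Y i j + W i j = 0" if ij: "i < n" "j < n" "A $$ (i, j) \<noteq> 0" for i j
      proof -
        have "{i, j} \<in> edges T" using edge_graph_of_iff[OF A skew ij(1,2)] ij(3) G by blast
        hence "{i, j} \<in> (\<lambda>k. {fst (e k), snd (e k)}) ` {..<n - 1}"
          unfolding bij_betw_imp_surj_on[OF bij] .
        then obtain c where "c \<in> {..<n - 1}" and s: "{i, j} = {fst (e c), snd (e c)}" by (rule imageE)
        hence c: "c < n - 1" by simp
        have "e c = (i, j) \<or> e c = (j, i)"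
          using s by (cases "e c") (auto simp: doubleton_eq_iff)
        thus ?thesis using edge[OF c] Ysk[OF ij(1,2)] Wsk[of i j] by (elim disjE) fastforce+
      qed
      show "duarte_on A {..<n} (n - 1)" using assms(6) by (simp add: duarte_def G assms(2))
      show "(n - 1, u) \<in> (adj (induced (graph_of A) {..<n}))\<^sup>*" if "u \<in> {..<n}" for u
      proof -
        have "adj (induced (graph_of A) {..<n}) = adj T"
          using sub by (auto simp: adj_def induced_def G)
        thus ?thesis using assms(1,2) that n by (auto simp: is_tree_def connected_graph_def)
      qed
      show "(\<Sum>k<n. A $$ (i, k) * (Y k j + W k j)) = (\<Sum>k<n. (Y i k + W i k) * A $$ (k, j))"
        if "i \<in> {..<n} - {n - 1}" "j \<in> {..<n} - {n - 1}" for i j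
      proof -
        have "i < n - 1" "j < n - 1" using that by auto
        from corner_commutator_zero[OF A this, where h = h and g = g and a = "\<lambda>r. v $ r" and b = "\<lambda>s. v $ (h + s)"]
        show ?thesis unfolding Y_def W_def .
      qed
    qed auto
    have "v $ k = 0" if k: "k < n - 1" for k
    proof -
      have "duarte_on A {..<n} (n - 1)" using assms(6) by (simp add: duarte_def G assms(2))
      hence "eigenvalues_strictly_interlace (submatrix A ({..<n} - {n - 1}) ({..<n} - {n - 1}))
          (submatrix A {..<n} {..<n})"
      proof cases
        \<comment> \<open>A single vertex would mean \<open>n = 1\<close>, leaving no index
          \<open>k < n - 1\<close>.\<close>
        case duarte_single
        hence "card {..<n} = card {n - 1}" by (rule arg_cong)
        thus ?thesis using k by simp
      qed
      moreover have "{..<n} - {n - 1} = {..<n - 1}" by auto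
      ultimately have il: "eigenvalues_strictly_interlace ?B A"
        using submatrix_lessThan[OF A, of n] submatrix_lessThan[OF A, of "n - 1"] corner_self[OF A] by simp
      have "(\<forall>r<h. v $ r = 0) \<and> (\<forall>s<g. v $ (h + s) = 0)"
      proof (rule strictly_interlacing_odd_power_sums_independent[OF A n il hg(2,3)])
        \<comment> \<open>The padding makes the last column of \<open>W\<close> zero, so that of
          \<open>Y\<close> vanishes on its own.\<close>
        show "(\<Sum>r<h. v $ r * (A ^\<^sub>m (2 * r + 1)) $$ (i, n - 1)) = 0" if "i < n" for i
          using bspec[OF bspec[OF X, of i], of "n - 1"] that n unfolding Y_def W_def by simp
        show "(\<Sum>r<h. v $ r * (A ^\<^sub>m (2 * r + 1)) $$ (i, j))
          + (\<Sum>s<g. v $ (h + s) * (?B ^\<^sub>m (2 * s + 1)) $$ (i, j)) = 0"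
          if "i < n - 1" "j < n - 1" for i j
          using bspec[OF bspec[OF X, of i], of j] that unfolding Y_def W_def by simp
      qed
      thus ?thesis using k hg(1) le_Suc_ex[of h k] by (cases "k < h") (auto simp: not_less le_iff_add)
    qed
    hence "v = 0\<^sub>v (n - 1)" using v(1) by (intro eq_vecI) auto
    thus False using v(2) by contradiction
  qed
  hence "det ?J \<noteq> 0" using Determinant.det_transpose[OF J] by simp
  thus ?thesis using det_nonzero_invertible_mat[OF J] by (simp add: x_def)
qed

end
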